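(* Let $\delta\in(0,1/2)$. Any randomized algorithm that, with probability at least $3/4$, outputs an $O(1)$-approximate solution for $k$-means on $n$ points using only queries to a weak oracle with failure probability $\delta$ must make $\Omega\big(\frac{nk}{(1-2\delta)^2}\big)$ weak-oracle queries in expectation.
   Context: Weak-oracle model: the input is a set $X$ of $n$ points in a metric space $(\mathcal{X},d)$ and an integer $k$; the algorithm may only query a weak oracle $\widetilde{WO}$ which, for any pair $x,y$, returns $d(x,y)$ with probability $1-\delta$ and an arbitrary value with probability $\delta$, independently across pairs, with persistent answers. The $k$-means problem asks for $k$ centers $C$ minimizing $\sum_{x\in X}\min_{c\in C}d(x,c)^2$.
   Formalization: The number of centers is restricted to 2 ≤ k < n; for k = 1 a uniformly random input point is a 16-approximation with probability at least 3/4 without queries, and for k = n outputting all points costs 0 without queries, so the claim fails there. *)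

theory Defs
  imports "HOL-Probability.Probability" "HOL-Analysis.Abstract_Metric_Spaces"
begin

text \<open>The \<open>n\<close> input points are labelled by \<open>{..<n}\<close>, and the metric space is the set of
  input points itself, so that centers are input points: these are the only points
  that an algorithm with access to a distance oracle on the input can name.\<close>

definition kmeans_cost :: "(nat \<Rightarrow> nat \<Rightarrow> real) \<Rightarrow> nat set \<Rightarrow> nat set \<Rightarrow> real" where
  "kmeans_cost d X C = (\<Sum>x\<in>X. Min ((\<lambda>c. (d x c)\<^sup>2) ` C))"

definition center_sets :: "nat set \<Rightarrow> nat \<Rightarrow> nat set set" where
  "center_sets X k = {C. C \<subseteq> X \<and> card C = k}"

definition kmeans_opt :: "(nat \<Rightarrow> nat \<Rightarrow> real) \<Rightarrow> nat set \<Rightarrow> nat \<Rightarrow> real" where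
  "kmeans_opt d X k = Min (kmeans_cost d X ` center_sets X k)"

definition approx_solutions ::
    "real \<Rightarrow> (nat \<Rightarrow> nat \<Rightarrow> real) \<Rightarrow> nat set \<Rightarrow> nat \<Rightarrow> nat set set" where
  "approx_solutions \<alpha> d X k =
     {C \<in> center_sets X k. kmeans_cost d X C \<le> \<alpha> * kmeans_opt d X k}"


definition point_pairs :: "nat \<Rightarrow> nat set set" where
  "point_pairs n = {e. e \<subseteq> {..<n} \<and> card e = 2}"

text \<open>The weak oracle is a random table of answers, drawn once before the algorithm starts, which
  makes the answers persistent. Every unordered pair of distinct points is corrupted independently
  with probability \<open>\<delta>\<close>; the answer on a corrupted pair \<open>e\<close> is the arbitrary value \<open>adv e\<close>.
  The corruption pattern is \<open>False\<close> outside \<open>point_pairs n\<close>, so a query \<open>(x, x)\<close>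
  returns \<open>d x x\<close>.\<close>

definition weak_oracle ::
    "nat \<Rightarrow> real \<Rightarrow> (nat \<Rightarrow> nat \<Rightarrow> real) \<Rightarrow> (nat set \<Rightarrow> real) \<Rightarrow> (nat \<Rightarrow> nat \<Rightarrow> real) pmf" where
  "weak_oracle n \<delta> d adv =
     map_pmf (\<lambda>corrupt x y. if corrupt {x, y} then adv {x, y} else d x y)
       (Pi_pmf (point_pairs n) False (\<lambda>_. bernoulli_pmf \<delta>))"


text \<open>A randomized algorithm chooses its next action at random, depending on the list of
  all previous queries and answers. The chosen actions
  are part of this history up to the halting step, so private randomness that is
  kept from one step to the next adds nothing to this model.\<close>

datatype action = Query nat nat | Output "nat set"

type_synonym history = "((nat \<times> nat) \<times> real) list"

type_synonym algorithm = "history \<Rightarrow> action pmf"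

definition queries_points :: "nat \<Rightarrow> algorithm \<Rightarrow> bool" where
  "queries_points n A \<longleftrightarrow> (\<forall>h x y. Query x y \<in> set_pmf (A h) \<longrightarrow> x < n \<and> y < n)"

datatype state = Running history | Halted history "nat set"

fun num_queries :: "state \<Rightarrow> nat" where
  "num_queries (Running h) = length h"
| "num_queries (Halted h C) = length h"

fun next_state :: "(nat \<Rightarrow> nat \<Rightarrow> real) \<Rightarrow> history \<Rightarrow> action \<Rightarrow> state" where
  "next_state f h (Query x y) = Running (h @ [((x, y), f x y)])"
| "next_state f h (Output C) = Halted h C"

fun step :: "algorithm \<Rightarrow> (nat \<Rightarrow> nat \<Rightarrow> real) \<Rightarrow> state \<Rightarrow> state pmf" where
  "step A f (Running h) = map_pmf (next_state f h) (A h)"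
| "step A f (Halted h C) = return_pmf (Halted h C)"

fun run :: "algorithm \<Rightarrow> (nat \<Rightarrow> nat \<Rightarrow> real) \<Rightarrow> nat \<Rightarrow> state pmf" where
  "run A f 0 = return_pmf (Running [])"
| "run A f (Suc t) = bind_pmf (run A f t) (step A f)"

definition weak_run ::
    "nat \<Rightarrow> real \<Rightarrow> (nat \<Rightarrow> nat \<Rightarrow> real) \<Rightarrow> (nat set \<Rightarrow> real) \<Rightarrow> algorithm \<Rightarrow> nat \<Rightarrow> state pmf" where
  "weak_run n \<delta> d adv A t = bind_pmf (weak_oracle n \<delta> d adv) (\<lambda>f. run A f t)"

text \<open>Algorithms need not terminate. The two suprema below are increasing limits over the number
  \<open>t\<close> of steps: the probability of ever halting with an output in \<open>G\<close>, and (by monotone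
  convergence) the expected total number of queries, which may be infinite.\<close>

definition output_prob ::
    "nat \<Rightarrow> real \<Rightarrow> (nat \<Rightarrow> nat \<Rightarrow> real) \<Rightarrow> (nat set \<Rightarrow> real) \<Rightarrow> algorithm \<Rightarrow> nat set set \<Rightarrow> real" where
  "output_prob n \<delta> d adv A G =
     (SUP t. measure_pmf.prob (weak_run n \<delta> d adv A t) {Halted h C | h C. C \<in> G})"

definition expected_queries ::
    "nat \<Rightarrow> real \<Rightarrow> (nat \<Rightarrow> nat \<Rightarrow> real) \<Rightarrow> (nat set \<Rightarrow> real) \<Rightarrow> algorithm \<Rightarrow> ennreal" where
  "expected_queries n \<delta> d adv A =
     (SUP t. \<integral>\<^sup>+ s. of_nat (num_queries s) \<partial>measure_pmf (weak_run n \<delta> d adv A t))"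

definition solves_kmeans :: "real \<Rightarrow> nat \<Rightarrow> nat \<Rightarrow> real \<Rightarrow> algorithm \<Rightarrow> bool" where
  "solves_kmeans \<alpha> n k \<delta> A \<longleftrightarrow>
     (\<forall>d adv. Metric_space {..<n} d \<longrightarrow>
        output_prob n \<delta> d adv A (approx_solutions \<alpha> d {..<n} k) \<ge> 3 / 4)"

end

theory Submission
  imports Defs
begin

text \<open>Take the metrics that have distance 1 between clusters and a tiny distance inside a cluster, with
  at most \<open>k\<close> clusters: an approximate solution must hit every cluster. The adversary answers a
  corrupted pair with the other possible distance, so an answer is a bit that is flipped with
  probability \<open>\<delta>\<close>, and two metrics that differ on the pairs in \<open>D\<close> are told apart only after about
  \<open>1 / (1 - 2\<delta>)\<^sup>2\<close> queries in \<open>D\<close>.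

  If \<open>3 k \<le> 2 n\<close>, label the points at random with \<open>k - 1\<close> clusters. Had the point \<open>x\<close> been isolated
  instead, it would have to be among the output centers. Unless the algorithm makes about
  \<open>(k - 1) / (1 - 2\<delta>)\<^sup>2\<close> queries at \<open>x\<close>, few of them fall into the average cluster, so that it cannot
  tell whether \<open>x\<close> is isolated or belongs to a random cluster. Hence almost \<open>3/4\<close> of the points would
  have to be heavily queried or be centers, but there are only \<open>k \<le> 2 n / 3\<close> centers.

  If \<open>3 k > 2 n\<close>, start from \<open>k + 1\<close> clusters of which \<open>k\<close> are singletons, and merge a hidden pair
  of singletons. The output must omit a point of this pair, so it is right for few of the about
  \<open>k\<^sup>2\<close> pairs only, and changing one pair changes one answer.\<close>

section \<open>Expected rewards along a run\<close>

type_synonym answers = "nat set \<Rightarrow> real"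

text \<open>Output probabilities and expected numbers of queries are all instances of this expected reward
  for a fixed table \<open>F\<close> of answers. The run is cut off at a query with \<open>stp h e\<close>, before its answer is
  read.\<close>

primrec reward :: "algorithm \<Rightarrow> (history \<Rightarrow> nat set \<Rightarrow> bool) \<Rightarrow> (history \<Rightarrow> nat set \<Rightarrow> ennreal) \<Rightarrow>
    (nat set \<Rightarrow> ennreal) \<Rightarrow> answers \<Rightarrow> nat \<Rightarrow> history \<Rightarrow> ennreal" where
  "reward A stp \<rho> \<omega> F 0 h = 0"
| "reward A stp \<rho> \<omega> F (Suc t) h =
     (\<integral>\<^sup>+a. (case a of
         Query x y \<Rightarrow> \<rho> h {x, y} +
           (if stp h {x, y} then 0 else reward A stp \<rho> \<omega> F t (h @ [((x, y), F {x, y})]))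
       | Output C \<Rightarrow> \<omega> C) \<partial>measure_pmf (A h))"

abbreviation never :: "history \<Rightarrow> nat set \<Rightarrow> bool" where
  "never \<equiv> \<lambda>_ _. False"

lemma nn_integral_measure_pmf_const [simp]: "(\<integral>\<^sup>+x. c \<partial>measure_pmf p) = c"
  using measure_pmf.emeasure_space_1[of p] by simp

lemma nn_integral_measure_pmf_mono:
  "(\<And>x. f x \<le> g x) \<Longrightarrow> (\<integral>\<^sup>+x. f x \<partial>measure_pmf p) \<le> (\<integral>\<^sup>+x. g x \<partial>measure_pmf p)"
  by (rule nn_integral_mono) simp

text \<open>Tonelli for discrete distributions, from the symmetry of \<open>pair_pmf\<close>. It
  moves the average over the answer table inside the average over the next action.\<close>

lemma nn_integral_measure_pmf_commute:
  "(\<integral>\<^sup>+x. \<integral>\<^sup>+y. f x y \<partial>measure_pmf q \<partial>measure_pmf p) = (\<integral>\<^sup>+y. \<integral>\<^sup>+x. f x y \<partial>measure_pmf p \<partial>measure_pmf q)"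
proof -
  have "(\<integral>\<^sup>+x. \<integral>\<^sup>+y. f x y \<partial>measure_pmf q \<partial>measure_pmf p) = (\<integral>\<^sup>+z. f (fst z) (snd z) \<partial>measure_pmf (pair_pmf p q))"
    by (simp add: nn_integral_pair_pmf')
  also have "\<dots> = (\<integral>\<^sup>+z. f (snd z) (fst z) \<partial>measure_pmf (pair_pmf q p))"
    by (subst pair_commute_pmf) (simp add: case_prod_unfold)
  finally show ?thesis
    by (simp add: nn_integral_pair_pmf')
qed

text \<open>Only sets of the form \<open>{x, y}\<close> are ever queried, so comparing
  \<open>\<rho>\<close> and \<open>\<rho>'\<close> on them suffices; this admits bounds such as "a
  query has at most two endpoints".\<close>

lemma reward_mono:
  assumes "\<And>h x y. \<rho> h {x, y} \<le> \<rho>' h {x, y}" "\<And>C. \<omega> C \<le> \<omega>' C"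
  shows "reward A stp \<rho> \<omega> F t h \<le> reward A stp \<rho>' \<omega>' F t h"
proof (induction t arbitrary: h)
  case (Suc t)
  show ?case
    unfolding reward.simps
    by (rule nn_integral_measure_pmf_mono)
      (auto split: action.split intro!: add_mono assms Suc)
qed simp

text \<open>Linearity for a common stopping rule: a sum over points or pairs becomes one reward that
  can be bounded history by history, which is how double counting enters.\<close>

lemma reward_sum:
  assumes "finite I"
  shows "(\<Sum>i\<in>I. reward A stp (\<rho> i) (\<omega> i) F t h) =
    reward A stp (\<lambda>h e. \<Sum>i\<in>I. \<rho> i h e) (\<lambda>C. \<Sum>i\<in>I. \<omega> i C) F t h"
proof (induction t arbitrary: h)
  case (Suc t)
  show ?case
    unfolding reward.simps
    by (subst nn_integral_sum[symmetric], simp, rule nn_integral_cong)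
      (auto split: action.split simp: sum.distrib Suc)
qed simp

lemma nn_integral_reward_sum:
  assumes "finite I"
  shows "(\<Sum>i\<in>I. \<integral>\<^sup>+F. reward A stp (\<rho> i) (\<omega> i) F t h \<partial>measure_pmf p) =
    (\<integral>\<^sup>+F. reward A stp (\<lambda>h e. \<Sum>i\<in>I. \<rho> i h e) (\<lambda>C. \<Sum>i\<in>I. \<omega> i C) F t h \<partial>measure_pmf p)"
  by (subst nn_integral_sum[symmetric]) (simp_all add: reward_sum[OF assms])

lemma reward_cmult:
  "reward A stp (\<lambda>h e. c * \<rho> h e) (\<lambda>C. c * \<omega> C) F t h = c * reward A stp \<rho> \<omega> F t h"
proof (induction t arbitrary: h)
  case (Suc t)
  show ?case
    unfolding reward.simps
    by (subst nn_integral_cmult[symmetric], simp, rule nn_integral_cong)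
      (auto split: action.split simp: distrib_left Suc)
qed simp

text \<open>A run produces at most one output.\<close>

lemma reward_output_le:
  assumes "\<And>C. \<omega> C \<le> c"
  shows "reward A stp (\<lambda>_ _. 0) \<omega> F t h \<le> c"
proof (induction t arbitrary: h)
  case (Suc t)
  have "reward A stp (\<lambda>_ _. 0) \<omega> F (Suc t) h \<le> (\<integral>\<^sup>+a. c \<partial>measure_pmf (A h))"
    unfolding reward.simps
    by (rule nn_integral_measure_pmf_mono) (auto split: action.split intro!: assms Suc)
  then show ?case by simp
qed simp

section \<open>Partially revealed answers\<close>

text \<open>Deferred decisions: \<open>R\<close> holds the pairs whose answers are still random,
  \<open>g\<close> the answers already fixed. The first query of a pair moves it from
  \<open>R\<close> to \<open>g\<close>.\<close>

definition answers_pmf :: "real \<Rightarrow> answers \<Rightarrow> answers \<Rightarrow> nat set set \<Rightarrow> answers \<Rightarrow> answers pmf" where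
  "answers_pmf \<delta> d adv R g =
     map_pmf (\<lambda>b e. if e \<in> R then (if b e then adv e else d e) else g e)
       (Pi_pmf R False (\<lambda>_. bernoulli_pmf \<delta>))"

lemma nn_integral_answers_revealed:
  assumes "e \<notin> R"
  shows "(\<integral>\<^sup>+F. \<phi> (F e) F \<partial>answers_pmf \<delta> d adv R g) = (\<integral>\<^sup>+F. \<phi> (g e) F \<partial>answers_pmf \<delta> d adv R g)"
  using assms by (simp add: answers_pmf_def)

text \<open>Conditioning on whether \<open>e\<close> is corrupted. Passing \<open>F e\<close> to
  \<open>\<phi>\<close> separately turns the answer into a constant in the history while the rest of
  the table stays random.\<close>

lemma nn_integral_answers_split:
  assumes "finite R" "e \<in> R" "0 < \<delta>" "\<delta> < 1"
  shows "(\<integral>\<^sup>+F. \<phi> (F e) F \<partial>answers_pmf \<delta> d adv R g) =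
     ennreal (1 - \<delta>) * (\<integral>\<^sup>+F. \<phi> (d e) F \<partial>answers_pmf \<delta> d adv (R - {e}) (g(e := d e))) +
     ennreal \<delta> * (\<integral>\<^sup>+F. \<phi> (adv e) F \<partial>answers_pmf \<delta> d adv (R - {e}) (g(e := adv e)))"
proof -
  have "Pi_pmf R False (\<lambda>_. bernoulli_pmf \<delta>) =
    Pi_pmf (insert e (R - {e})) False (\<lambda>_. bernoulli_pmf \<delta>)"
    using assms(2) by (simp add: insert_absorb)
  also have "\<dots> = bind_pmf (bernoulli_pmf \<delta>) (\<lambda>y. map_pmf (\<lambda>f. f(e := y))
      (Pi_pmf (R - {e}) False (\<lambda>_. bernoulli_pmf \<delta>)))"
    using assms(1) by (subst Pi_pmf_insert') (auto simp: map_pmf_def)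
  finally have eq: "answers_pmf \<delta> d adv R g = bind_pmf (bernoulli_pmf \<delta>)
      (\<lambda>y. answers_pmf \<delta> d adv (R - {e}) (g(e := if y then adv e else d e)))"
    unfolding answers_pmf_def using assms(2)
    by (auto simp: map_bind_pmf pmf.map_comp intro!: bind_pmf_cong map_pmf_cong)
  show ?thesis
    unfolding eq using assms
    by (simp add: nn_integral_answers_revealed[of e] mult.commute add.commute)
qed

lemma finite_point_pairs: "finite (point_pairs n)"
  unfolding point_pairs_def by (rule finite_subset[of _ "Pow {..<n}"]) auto

text \<open>Outside \<open>point_pairs n\<close> nothing is corrupted and the oracle returns
  \<open>d e\<close>, hence the condition on \<open>g\<close>.\<close>

lemma weak_oracle_eq_answers_pmf:
  assumes "\<And>e. e \<notin> point_pairs n \<Longrightarrow> g e = d e"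
  shows "weak_oracle n \<delta> (\<lambda>x y. d {x, y}) adv =
    map_pmf (\<lambda>F x y. F {x, y}) (answers_pmf \<delta> d adv (point_pairs n) g)"
  unfolding weak_oracle_def answers_pmf_def pmf.map_comp o_def
  using assms set_Pi_pmf_subset[OF finite_point_pairs, of n False "\<lambda>_. bernoulli_pmf \<delta>"]
  by (intro map_pmf_cong refl) (fastforce simp: fun_eq_iff)

section \<open>Distinguishing two tables of answers\<close>

text \<open>The bound \<open>|x - y| \<le> r\<close>, stated without the truncated subtraction of
  \<open>ennreal\<close>.\<close>

definition near :: "ennreal \<Rightarrow> ennreal \<Rightarrow> ennreal \<Rightarrow> bool" where
  "near x y r \<longleftrightarrow> x \<le> y + r \<and> y \<le> x + r"

lemma near_nn_integral:
  assumes "\<And>a. near (f a) (g a) (r a)"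
  shows "near (\<integral>\<^sup>+a. f a \<partial>measure_pmf p) (\<integral>\<^sup>+a. g a \<partial>measure_pmf p) (\<integral>\<^sup>+a. r a \<partial>measure_pmf p)"
  using assms unfolding near_def
  by (auto simp flip: nn_integral_add intro!: nn_integral_measure_pmf_mono)

lemma near_add:
  assumes "near x y r" "near x' y' r'"
  shows "near (x + x') (y + y') (r + r')"
  using add_mono[of x "y + r" x' "y' + r'"] add_mono[of y "x + r" y' "x' + r'"] assms
  unfolding near_def by (simp add: ac_simps)

lemma near_mono: "near x y r \<Longrightarrow> r \<le> r' \<Longrightarrow> near x y r'"
  unfolding near_def by (meson add_left_mono order_trans)

text \<open>\<open>tri p q\<close> is the triangular discrimination, the potential function of the argument. Unlike
  the Kullback-Leibler divergence, it grows by at most \<open>4 (1 - 2\<delta>)\<^sup>2 p\<close> per informative answer, also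
  for \<open>\<delta>\<close> close to 0. Here \<open>tri 0 0 = 0\<close>.\<close>

definition tri :: "real \<Rightarrow> real \<Rightarrow> real" where
  "tri p q = (p - q)\<^sup>2 / (p + q)"

lemma tri_nonneg: "0 \<le> p \<Longrightarrow> 0 \<le> q \<Longrightarrow> 0 \<le> tri p q"
  by (simp add: tri_def)

text \<open>Homogeneity of degree 1: an answer that is equally likely under both hypotheses only
  redistributes the potential.\<close>

lemma tri_scale: "tri (c * p) (c * q) = c * tri p q"
proof (cases "c = 0")
  case False
  have "tri (c * p) (c * q) = (c * (c * (p - q)\<^sup>2)) / (c * (p + q))"
    unfolding tri_def by (simp add: algebra_simps power2_eq_square)
  also have "\<dots> = c * tri p q"
    using False unfolding tri_def by (simp add: mult_divide_mult_cancel_left)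
  finally show ?thesis .
qed (simp add: tri_def)

text \<open>The sum minus twice the harmonic mean. Splitting weights over answers preserves the sum,
  so only harmonic means have to be compared.\<close>

lemma tri_altdef: "0 \<le> p \<Longrightarrow> 0 \<le> q \<Longrightarrow> tri p q = p + q - 4 * (p * q / (p + q))"
  by (cases "p + q = 0") (auto simp: tri_def field_simps power2_eq_square)

text \<open>The two hypotheses predict opposite bits, each flipped with probability \<delta>. For
  positive weights the potential grows by exactly \<open>4 * (1 - 2 * \<delta>)^2 * p\<close> times
  two factors that are at most 1.\<close>

lemma tri_noisy_bit:
  assumes "0 < \<delta>" "\<delta> < 1/2" "0 \<le> p" "0 \<le> q"
  shows "tri ((1 - \<delta>) * p) (\<delta> * q) + tri (\<delta> * p) ((1 - \<delta>) * q) \<le> tri p q + 4 * (1 - 2 * \<delta>)\<^sup>2 * p"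
\<comment> \<open>If one weight vanishes, \<open>tri\<close> is the other weight, and splitting
  preserves it.\<close>
proof (cases "p = 0 \<or> q = 0")
  case True
  then show ?thesis
  proof
    assume "p = 0"
    have "tri ((1 - \<delta>) * 0) (\<delta> * q) + tri (\<delta> * 0) ((1 - \<delta>) * q) = tri 0 q"
      using tri_scale[of \<delta> 0 q] tri_scale[of "1 - \<delta>" 0 q] by (simp add: algebra_simps)
    with \<open>p = 0\<close> show ?thesis by simp
  next
    assume "q = 0"
    have "tri ((1 - \<delta>) * p) (\<delta> * 0) + tri (\<delta> * p) ((1 - \<delta>) * 0) = tri p 0"
      using tri_scale[of \<delta> p 0] tri_scale[of "1 - \<delta>" p 0] by (simp add: algebra_simps)
    with \<open>q = 0\<close> assms show ?thesis by simp
  qed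
next
  case False
  with assms have pq: "0 < p" "0 < q" by auto
  define \<epsilon> where "\<epsilon> = 1 - 2 * \<delta>"
  define S where "S = p + q"
  \<comment> \<open>\<open>m0\<close> and \<open>m1\<close> are the combined weights of the two
    possible answers.\<close>
  define m0 where "m0 = (1 - \<delta>) * p + \<delta> * q"
  define m1 where "m1 = \<delta> * p + (1 - \<delta>) * q"
  have pos: "0 < m0" "0 < m1" "0 < S"
    using assms pq unfolding m0_def m1_def S_def by (auto intro!: add_pos_pos mult_pos_pos)
  have S: "m0 + m1 = S"
    unfolding m0_def m1_def S_def by (simp add: algebra_simps)
  \<comment> \<open>The first summand cancels against the old potential; the second one is the
    source of the factor \<open>\<epsilon>^2\<close>.\<close>
  have mm: "m0 * m1 = \<delta> * (1 - \<delta>) * S\<^sup>2 + \<epsilon>\<^sup>2 * (p * q)"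
    unfolding m0_def m1_def S_def \<epsilon>_def by (simp add: algebra_simps power2_eq_square)
  have "m0 * m1 = p * q + \<delta> * (1 - \<delta>) * (p - q)\<^sup>2"
    unfolding m0_def m1_def by (simp add: algebra_simps power2_eq_square)
  then have mm_ge: "p * q \<le> m0 * m1"
    using assms by simp
  have inv: "1 / m0 + 1 / m1 = S / (m0 * m1)"
    using pos S by (simp add: field_simps)
  have "tri ((1 - \<delta>) * p) (\<delta> * q) + tri (\<delta> * p) ((1 - \<delta>) * q) - tri p q
      = 4 * (p * q / S) - 4 * (\<delta> * (1 - \<delta>) * (p * q)) * (1 / m0 + 1 / m1)"
  proof -
    have "tri ((1 - \<delta>) * p) (\<delta> * q) = m0 - 4 * (\<delta> * (1 - \<delta>) * (p * q) / m0)"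
      "tri (\<delta> * p) ((1 - \<delta>) * q) = m1 - 4 * (\<delta> * (1 - \<delta>) * (p * q) / m1)"
      "tri p q = S - 4 * (p * q / S)"
      using assms pq by (auto simp: tri_altdef m0_def m1_def S_def ac_simps)
    moreover have "\<delta> * (1 - \<delta>) * (p * q) / m0 + \<delta> * (1 - \<delta>) * (p * q) / m1
        = \<delta> * (1 - \<delta>) * (p * q) * (1 / m0 + 1 / m1)"
      by (simp add: distrib_left)
    ultimately show ?thesis using S by linarith
  qed
  also have "\<dots> = 4 * (p * q / (S * (m0 * m1))) * (m0 * m1 - \<delta> * (1 - \<delta>) * S\<^sup>2)"
    unfolding inv using pos by (simp add: field_simps power2_eq_square)
  also have "\<dots> = 4 * \<epsilon>\<^sup>2 * p * ((p * q) / (m0 * m1)) * (q / S)"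
    unfolding mm using pos by (simp add: field_simps)
  also have "\<dots> \<le> 4 * \<epsilon>\<^sup>2 * p * 1 * 1"
    using pq pos mm_ge by (intro mult_mono) (auto simp: S_def)
  finally show ?thesis
    by (simp add: \<epsilon>_def)
qed

text \<open>Since \<open>|p - q|^2 = tri p q * (p + q)\<close>, this is AM-GM with a free parameter
  \<kappa>. The linear form can be summed over the branches of the query tree.\<close>

lemma abs_diff_le_tri:
  assumes "0 \<le> p" "0 \<le> q" "0 < \<kappa>"
  shows "\<bar>p - q\<bar> \<le> \<kappa> / 2 * (p + q) + tri p q / (2 * \<kappa>)"
proof (cases "p + q = 0")
  case False
  with assms have pos: "0 < p + q" by simp
  have "0 \<le> (\<bar>p - q\<bar> - \<kappa> * (p + q))\<^sup>2" by simp
  then have "\<bar>p - q\<bar> * (2 * \<kappa> * (p + q)) \<le> (p - q)\<^sup>2 + (\<kappa> * (p + q))\<^sup>2"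
    by (simp add: power2_diff algebra_simps)
  then have "\<bar>p - q\<bar> \<le> ((p - q)\<^sup>2 + (\<kappa> * (p + q))\<^sup>2) / (2 * \<kappa> * (p + q))"
    using pos assms(3) by (simp add: pos_le_divide_eq)
  also have "\<dots> = \<kappa> / 2 * (p + q) + tri p q / (2 * \<kappa>)"
  proof -
    have "(\<kappa> * (p + q))\<^sup>2 / (2 * \<kappa> * (p + q)) = \<kappa> / 2 * (p + q)"
      using pos assms(3) by (simp add: power2_eq_square divide_simps)
    then show ?thesis
      by (simp add: tri_def add_divide_distrib mult.commute mult.left_commute)
  qed
  finally show ?thesis .
qed (use assms in \<open>auto simp: tri_def\<close>)

section \<open>The error budget along the query tree\<close>

lemma near_ennreal:
  assumes "0 \<le> p" "0 \<le> q" "\<bar>p - q\<bar> \<le> r"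
  shows "near (ennreal p) (ennreal q) (ennreal r)"
  using assms unfolding near_def by (auto simp flip: ennreal_plus intro!: ennreal_leI)

text \<open>The right-hand side of \<open>abs_diff_le_tri\<close>: the error allowed at a history
  with likelihoods \<open>p\<close> and \<open>q\<close>.\<close>

definition slack :: "real \<Rightarrow> real \<Rightarrow> real \<Rightarrow> real" where
  "slack \<kappa> p q = \<kappa> / 2 * (p + q) + tri p q / (2 * \<kappa>)"

lemma slack_nonneg: "0 < \<kappa> \<Longrightarrow> 0 \<le> p \<Longrightarrow> 0 \<le> q \<Longrightarrow> 0 \<le> slack \<kappa> p q"
  by (simp add: slack_def tri_nonneg)

text \<open>For a pair outside \<open>D\<close> the answer has the same law under both hypotheses,
  so the budget is just divided between the two answers.\<close>

lemma slack_split: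
  "slack \<kappa> ((1 - \<delta>) * p) ((1 - \<delta>) * q) + slack \<kappa> (\<delta> * p) (\<delta> * q) = slack \<kappa> p q"
  unfolding slack_def tri_scale by (simp add: diff_divide_distrib algebra_simps)

text \<open>The linear part of the budget is preserved; the growth is that of \<open>tri\<close>,
  divided by \<open>2 * \<kappa>\<close>.\<close>

lemma slack_noisy_bit:
  assumes "0 < \<delta>" "\<delta> < 1/2" "0 \<le> p" "0 \<le> q" "0 < \<kappa>"
  shows "slack \<kappa> ((1 - \<delta>) * p) (\<delta> * q) + slack \<kappa> (\<delta> * p) ((1 - \<delta>) * q)
    \<le> slack \<kappa> p q + 2 * (1 - 2 * \<delta>)\<^sup>2 / \<kappa> * p"
proof -
  have "(tri ((1 - \<delta>) * p) (\<delta> * q) + tri (\<delta> * p) ((1 - \<delta>) * q)) / (2 * \<kappa>)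
      \<le> (tri p q + 4 * (1 - 2 * \<delta>)\<^sup>2 * p) / (2 * \<kappa>)"
    using tri_noisy_bit[OF assms(1-4)] assms(5) by (intro divide_right_mono) auto
  also have "\<dots> = tri p q / (2 * \<kappa>) + 2 * (1 - 2 * \<delta>)\<^sup>2 / \<kappa> * p"
    by (simp add: add_divide_distrib)
  finally show ?thesis
    unfolding slack_def by (simp add: add_divide_distrib algebra_simps)
qed

text \<open>The weights \<open>p\<close> and \<open>q\<close> are the likelihoods of the history \<open>h\<close> under the two hypotheses.\<close>

lemma near_reward:
  fixes \<delta> \<kappa> :: real and A :: algorithm and stp :: "history \<Rightarrow> nat set \<Rightarrow> bool" and G :: "nat set set"
  assumes \<delta>: "0 < \<delta>" "\<delta> < 1/2" and \<kappa>: "0 < \<kappa>"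
    and swapped: "\<And>e. e \<in> D \<Longrightarrow> d' e = adv e \<and> adv' e = d e"
    and same: "\<And>e. e \<notin> D \<Longrightarrow> d' e = d e \<and> adv' e = adv e"
  defines "val \<equiv> reward A stp (\<lambda>h e. of_bool (stp h e)) (\<lambda>C. of_bool (C \<in> G))"
    and "num \<equiv> reward A stp (\<lambda>h e. of_bool (e \<in> D \<and> \<not> stp h e)) (\<lambda>_. 0)"
    and "k \<equiv> 2 * (1 - 2 * \<delta>)\<^sup>2 / \<kappa>"
  assumes "finite R" "0 \<le> p" "0 \<le> q"
  shows "near (ennreal p * (\<integral>\<^sup>+F. val F t h \<partial>answers_pmf \<delta> d adv R g))
      (ennreal q * (\<integral>\<^sup>+F. val F t h \<partial>answers_pmf \<delta> d' adv' R g))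
      (ennreal (slack \<kappa> p q) + ennreal (k * p) * (\<integral>\<^sup>+F. num F t h \<partial>answers_pmf \<delta> d adv R g))"
  using assms(9-)
proof (induction t arbitrary: h R g p q)
  case 0
  then show ?case
    by (simp add: val_def near_def)
next
  case (Suc t)
  let ?O = "answers_pmf \<delta> d adv" and ?O' = "answers_pmf \<delta> d' adv'"
  \<comment> \<open>\<open>V\<close> and \<open>N\<close> are the contents of \<open>val\<close> and
    \<open>num\<close> once the next action \<open>a\<close> is known. A stop is worth 1, and the
    query that causes it is not counted.\<close>
  define V where "V F a = (case a of
      Query x y \<Rightarrow> of_bool (stp h {x, y}) + (if stp h {x, y} then 0 else val F t (h @ [((x, y), F {x, y})]))
    | Output C \<Rightarrow> of_bool (C \<in> G))" for F a
  define N where "N F a = (case a of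
      Query x y \<Rightarrow> of_bool ({x, y} \<in> D \<and> \<not> stp h {x, y}) + (if stp h {x, y} then 0 else num F t (h @ [((x, y), F {x, y})]))
    | Output C \<Rightarrow> 0)" for F a
  have k: "0 \<le> k"
    using \<kappa> by (simp add: k_def)
  have val_Suc: "val F (Suc t) h = (\<integral>\<^sup>+a. V F a \<partial>measure_pmf (A h))" for F
    unfolding val_def V_def by simp
  have num_Suc: "num F (Suc t) h = (\<integral>\<^sup>+a. N F a \<partial>measure_pmf (A h))" for F
    unfolding num_def N_def by simp
  \<comment> \<open>At an output or a stop, the two sides are the likelihoods themselves or both
    0.\<close>
  have leaf: "near (ennreal p) (ennreal q) (ennreal (slack \<kappa> p q) + r)" for r
    using near_ennreal[OF Suc.prems(2,3), of "slack \<kappa> p q"] abs_diff_le_tri[OF Suc.prems(2,3) \<kappa>]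
    unfolding slack_def by (auto elim: near_mono)
  have leaf0: "near 0 0 r" for r
    by (simp add: near_def)
  have pointwise: "near (ennreal p * (\<integral>\<^sup>+F. V F a \<partial>?O R g)) (ennreal q * (\<integral>\<^sup>+F. V F a \<partial>?O' R g))
      (ennreal (slack \<kappa> p q) + ennreal (k * p) * (\<integral>\<^sup>+F. N F a \<partial>?O R g))" for a
  proof (cases a)
    case (Output C)
    then show ?thesis
      by (auto simp: V_def leaf leaf0)
  next
    case (Query x y)
    define e where "e = {x, y}"
    define ext where "ext v = h @ [((x, y), v)]" for v :: real
    show ?thesis
    proof (cases "stp h e")
      case True
      with Query leaf show ?thesis
        by (auto simp: V_def e_def)
    next
      case False
      have V: "V F a = val F t (ext (F e))" for F
        using Query False by (simp add: V_def e_def ext_def)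
      have N: "N F a = of_bool (e \<in> D) + num F t (ext (F e))" for F
        using Query False by (simp add: N_def e_def ext_def)
      show ?thesis
      proof (cases "e \<in> R")
        \<comment> \<open>The answer is already fixed, and it is the same under both hypotheses. A
          repeated query in \<open>D\<close> may still be counted, which only enlarges the error
          term.\<close>
        case notin: False
        have "near (ennreal p * (\<integral>\<^sup>+F. V F a \<partial>?O R g)) (ennreal q * (\<integral>\<^sup>+F. V F a \<partial>?O' R g))
          (ennreal (slack \<kappa> p q) + ennreal (k * p) * (\<integral>\<^sup>+F. num F t (ext (F e)) \<partial>?O R g))"
          unfolding V
            nn_integral_answers_revealed[OF notin, where \<phi> = "\<lambda>v F. val F t (ext v)"]
            nn_integral_answers_revealed[OF notin, where \<phi> = "\<lambda>v F. num F t (ext v)"]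
          by (rule Suc.IH[OF Suc.prems])
        then show ?thesis
          by (rule near_mono) (auto simp: N intro!: add_left_mono mult_left_mono nn_integral_measure_pmf_mono)
      next
        case e: True
        have fin: "finite (R - {e})" using Suc.prems by simp
        have \<delta>1: "\<delta> < 1" "0 \<le> \<delta>" "0 \<le> 1 - \<delta>" using \<delta> by auto
        define I where "I p' q' v = (ennreal (slack \<kappa> p' q') + ennreal (k * p') *
            (\<integral>\<^sup>+F. num F t (ext v) \<partial>?O (R - {e}) (g(e := v))))" for p' q' v
        have IH: "near (ennreal p' * (\<integral>\<^sup>+F. val F t (ext v) \<partial>?O (R - {e}) (g(e := v))))
           (ennreal q' * (\<integral>\<^sup>+F. val F t (ext v) \<partial>?O' (R - {e}) (g(e := v)))) (I p' q' v)"
          if "0 \<le> p'" "0 \<le> q'" for p' q' v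
          unfolding I_def by (rule Suc.IH[OF fin that])
        have EV: "ennreal p * (\<integral>\<^sup>+F. V F a \<partial>?O R g) =
            ennreal ((1 - \<delta>) * p) * (\<integral>\<^sup>+F. val F t (ext (d e)) \<partial>?O (R - {e}) (g(e := d e))) +
            ennreal (\<delta> * p) * (\<integral>\<^sup>+F. val F t (ext (adv e)) \<partial>?O (R - {e}) (g(e := adv e)))"
          unfolding V
          using Suc.prems \<delta>1 \<delta> e
          by (subst nn_integral_answers_split[where \<phi> = "\<lambda>v F. val F t (ext v)"])
            (auto simp: ennreal_mult distrib_left ac_simps)
        have EV': "ennreal q * (\<integral>\<^sup>+F. V F a \<partial>?O' R g) =
            ennreal ((1 - \<delta>) * q) * (\<integral>\<^sup>+F. val F t (ext (d' e)) \<partial>?O' (R - {e}) (g(e := d' e))) +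
            ennreal (\<delta> * q) * (\<integral>\<^sup>+F. val F t (ext (adv' e)) \<partial>?O' (R - {e}) (g(e := adv' e)))"
          unfolding V
          using Suc.prems \<delta>1 \<delta> e
          by (subst nn_integral_answers_split[where \<phi> = "\<lambda>v F. val F t (ext v)"])
            (auto simp: ennreal_mult distrib_left ac_simps)
        have EN: "ennreal (k * p) * (\<integral>\<^sup>+F. N F a \<partial>?O R g) =
            ennreal (k * p) * of_bool (e \<in> D) +
            (ennreal (k * ((1 - \<delta>) * p)) * (\<integral>\<^sup>+F. num F t (ext (d e)) \<partial>?O (R - {e}) (g(e := d e))) +
            ennreal (k * (\<delta> * p)) * (\<integral>\<^sup>+F. num F t (ext (adv e)) \<partial>?O (R - {e}) (g(e := adv e))))"
        proof -
          have "(\<integral>\<^sup>+F. N F a \<partial>?O R g) = of_bool (e \<in> D) + (\<integral>\<^sup>+F. num F t (ext (F e)) \<partial>?O R g)"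
            unfolding N by (subst nn_integral_add) auto
          then show ?thesis
            using Suc.prems \<delta>1 \<delta> e k
            by (subst (asm) nn_integral_answers_split[where \<phi> = "\<lambda>v F. num F t (ext v)"])
              (auto simp: ennreal_mult distrib_left ac_simps)
        qed
        show ?thesis
        proof (cases "e \<in> D")
          case True
          \<comment> \<open>The answer \<open>d e\<close> is truthful under the first hypothesis and
            corrupted under the second, so the likelihoods become \<open>(1 - \<delta>) * p\<close>
            and \<open>\<delta> * q\<close>; for \<open>adv e\<close> the roles are
            exchanged.\<close>
          have sw: "d' e = adv e" "adv' e = d e"
            using swapped[OF True] by auto
          have "near (ennreal p * (\<integral>\<^sup>+F. V F a \<partial>?O R g)) (ennreal q * (\<integral>\<^sup>+F. V F a \<partial>?O' R g))
            (I ((1 - \<delta>) * p) (\<delta> * q) (d e) + I (\<delta> * p) ((1 - \<delta>) * q) (adv e))"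
            using near_add[OF IH[of "(1 - \<delta>) * p" "\<delta> * q" "d e"] IH[of "\<delta> * p" "(1 - \<delta>) * q" "adv e"]]
              Suc.prems \<delta>1
            unfolding EV EV' sw by (simp add: ac_simps)
          moreover have "ennreal (slack \<kappa> ((1 - \<delta>) * p) (\<delta> * q)) + ennreal (slack \<kappa> (\<delta> * p) ((1 - \<delta>) * q))
              \<le> ennreal (slack \<kappa> p q) + ennreal (k * p)"
            using slack_noisy_bit[OF \<delta> Suc.prems(2,3) \<kappa>] Suc.prems \<kappa> \<delta>1 k
            by (simp add: slack_nonneg k_def flip: ennreal_plus)
          ultimately show ?thesis
            unfolding EN I_def using True
            by (elim near_mono) (auto simp: add.assoc add.left_commute
                dest: add_right_mono intro: order_trans)
        next
          case notD: False
          have sm: "d' e = d e" "adv' e = adv e"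
            using same[OF notD] by auto
          have "near (ennreal p * (\<integral>\<^sup>+F. V F a \<partial>?O R g)) (ennreal q * (\<integral>\<^sup>+F. V F a \<partial>?O' R g))
            (I ((1 - \<delta>) * p) ((1 - \<delta>) * q) (d e) + I (\<delta> * p) (\<delta> * q) (adv e))"
            using near_add[OF IH[of "(1 - \<delta>) * p" "(1 - \<delta>) * q" "d e"] IH[of "\<delta> * p" "\<delta> * q" "adv e"]]
              Suc.prems \<delta>1
            unfolding EV EV' sm by simp
          moreover have eq: "ennreal (slack \<kappa> ((1 - \<delta>) * p) ((1 - \<delta>) * q)) + ennreal (slack \<kappa> (\<delta> * p) (\<delta> * q))
              = ennreal (slack \<kappa> p q)"
            using slack_split[of \<kappa> \<delta> p q] Suc.prems \<kappa> \<delta>1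
            by (simp add: slack_nonneg flip: ennreal_plus)
          ultimately show ?thesis
            unfolding EN I_def eq[symmetric] using notD by (simp add: ac_simps)
        qed
      qed
    qed
  qed
  \<comment> \<open>The law of the action depends on the history alone, so it is common to both
    hypotheses and the pointwise bounds can be averaged.\<close>
  have "near (\<integral>\<^sup>+a. ennreal p * (\<integral>\<^sup>+F. V F a \<partial>?O R g) \<partial>measure_pmf (A h))
      (\<integral>\<^sup>+a. ennreal q * (\<integral>\<^sup>+F. V F a \<partial>?O' R g) \<partial>measure_pmf (A h))
      (\<integral>\<^sup>+a. ennreal (slack \<kappa> p q) + ennreal (k * p) * (\<integral>\<^sup>+F. N F a \<partial>?O R g) \<partial>measure_pmf (A h))"
    by (rule near_nn_integral[OF pointwise])
  then show ?case
    unfolding val_Suc num_Suc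
    by (simp add: nn_integral_cmult nn_integral_add nn_integral_measure_pmf_commute[where p = "A h"])
qed

text \<open>Both likelihoods are initially 1, where \<open>slack\<close> equals \<kappa>. The second
  error term exceeds \<kappa> only if more than
  \<open>\<kappa>^2 / (2 * (1 - 2 * \<delta>)^2)\<close> queries in \<open>D\<close> are
  expected.\<close>

corollary near_reward_start:
  fixes \<delta> \<kappa> :: real and A :: algorithm and stp :: "history \<Rightarrow> nat set \<Rightarrow> bool" and G :: "nat set set"
  assumes "0 < \<delta>" "\<delta> < 1/2" "0 < \<kappa>" "finite R"
    and "\<And>e. e \<in> D \<Longrightarrow> d' e = adv e \<and> adv' e = d e"
    and "\<And>e. e \<notin> D \<Longrightarrow> d' e = d e \<and> adv' e = adv e"
  shows "near
      (\<integral>\<^sup>+F. reward A stp (\<lambda>h e. of_bool (stp h e)) (\<lambda>C. of_bool (C \<in> G)) F t h \<partial>answers_pmf \<delta> d adv R g)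
      (\<integral>\<^sup>+F. reward A stp (\<lambda>h e. of_bool (stp h e)) (\<lambda>C. of_bool (C \<in> G)) F t h \<partial>answers_pmf \<delta> d' adv' R g)
      (ennreal \<kappa> + ennreal (2 * (1 - 2 * \<delta>)\<^sup>2 / \<kappa>) *
        (\<integral>\<^sup>+F. reward A stp (\<lambda>h e. of_bool (e \<in> D \<and> \<not> stp h e)) (\<lambda>_. 0) F t h \<partial>answers_pmf \<delta> d adv R g))"
  using near_reward[OF assms(1-3,5,6,4), where p = 1 and q = 1 and A = A and stp = stp and G = G and t = t and h = h and g = g]
  by (simp add: slack_def tri_def)

section \<open>Runs of an algorithm as rewards\<close>

text \<open>\<open>run\<close> appends steps at the end, while \<open>reward\<close> recurses on the
  first step; this version unfolds from the front to match \<open>reward\<close>.\<close>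

primrec steps :: "algorithm \<Rightarrow> (nat \<Rightarrow> nat \<Rightarrow> real) \<Rightarrow> nat \<Rightarrow> state \<Rightarrow> state pmf" where
  "steps A f 0 s = return_pmf s"
| "steps A f (Suc t) s = bind_pmf (step A f s) (steps A f t)"

lemma bind_run_steps: "bind_pmf (run A f t) (steps A f u) = run A f (t + u)"
proof (induction u arbitrary: t)
  case 0
  have "steps A f 0 = return_pmf" by auto
  then show ?case by (simp add: bind_return_pmf')
next
  case (Suc u)
  have "steps A f (Suc u) = (\<lambda>s. bind_pmf (step A f s) (steps A f u))" by auto
  then have "bind_pmf (run A f t) (steps A f (Suc u)) = bind_pmf (run A f (Suc t)) (steps A f u)"
    by (simp add: bind_assoc_pmf)
  then show ?case by (simp only: Suc add_Suc_right add_Suc)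
qed

lemma run_eq_steps: "run A f t = steps A f t (Running [])"
  using bind_run_steps[of A f 0 t] by (simp add: bind_return_pmf)

lemma steps_Halted [simp]: "steps A f t (Halted h C) = return_pmf (Halted h C)"
  by (induction t) (auto simp: bind_return_pmf)

lemma emeasure_steps_Halted:
  "emeasure (measure_pmf (steps A (\<lambda>x y. F {x, y}) t (Running h))) {Halted h C | h C. C \<in> G} =
     reward A never (\<lambda>_ _. 0) (\<lambda>C. of_bool (C \<in> G)) F t h"
proof (induction t arbitrary: h)
  case (Suc t)
  show ?case
    by (auto simp: Suc split: action.split intro!: nn_integral_cong)
qed simp

lemma nn_integral_steps_num_queries:
  "(\<integral>\<^sup>+s. of_nat (num_queries s) \<partial>steps A (\<lambda>x y. F {x, y}) t (Running h)) =
     of_nat (length h) + reward A never (\<lambda>_ _. 1) (\<lambda>_. 0) F t h"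
proof (induction t arbitrary: h)
  case (Suc t)
  have "(\<integral>\<^sup>+s. of_nat (num_queries s) \<partial>steps A (\<lambda>x y. F {x, y}) (Suc t) (Running h)) =
      (\<integral>\<^sup>+a. of_nat (length h) + (case a of
         Query x y \<Rightarrow> 1 + reward A never (\<lambda>_ _. 1) (\<lambda>_. 0) F t (h @ [((x, y), F {x, y})])
       | Output C \<Rightarrow> 0) \<partial>measure_pmf (A h))"
    by (auto simp: Suc ac_simps split: action.split intro!: nn_integral_cong)
  also have "\<dots> = of_nat (length h) + reward A never (\<lambda>_ _. 1) (\<lambda>_. 0) F (Suc t) h"
    by (simp add: nn_integral_add)
  finally show ?case .
qed simp

section \<open>Passing from the limit to a finite time horizon\<close>

lemma reward_Suc_mono: "reward A stp \<rho> \<omega> F t h \<le> reward A stp \<rho> \<omega> F (Suc t) h"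
proof (induction t arbitrary: h)
  case (Suc t)
  show ?case
    unfolding reward.simps(2)[of A stp \<rho> \<omega> F t h] reward.simps(2)[of A stp \<rho> \<omega> F "Suc t" h]
    by (intro nn_integral_measure_pmf_mono)
      (auto split: action.split intro!: add_left_mono Suc simp del: reward.simps)
qed simp

lemma reward_mono_time: "t \<le> u \<Longrightarrow> reward A stp \<rho> \<omega> F t h \<le> reward A stp \<rho> \<omega> F u h"
  by (rule lift_Suc_mono_le[where f = "\<lambda>t. reward A stp \<rho> \<omega> F t h"]) (rule reward_Suc_mono)

text \<open>The supremum may be reached only in the limit, so a strictly smaller bound is claimed.
  It holds from some time on, which later allows one horizon for finitely many metrics.\<close>

lemma output_prob_ge_imp_reward:
  assumes g: "\<And>e. e \<notin> point_pairs n \<Longrightarrow> g e = d e"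
    and "c \<le> output_prob n \<delta> (\<lambda>x y. d {x, y}) adv A G" "c' < c"
  shows "\<exists>t0. \<forall>t\<ge>t0. ennreal c' \<le>
    (\<integral>\<^sup>+F. reward A never (\<lambda>_ _. 0) (\<lambda>C. of_bool (C \<in> G)) F t [] \<partial>answers_pmf \<delta> d adv (point_pairs n) g)"
proof -
  let ?p = "\<lambda>t. measure_pmf.prob (weak_run n \<delta> (\<lambda>x y. d {x, y}) adv A t) {Halted h C | h C. C \<in> G}"
  let ?I = "\<lambda>t. \<integral>\<^sup>+F. reward A never (\<lambda>_ _. 0) (\<lambda>C. of_bool (C \<in> G)) F t []
    \<partial>answers_pmf \<delta> d adv (point_pairs n) g"
  have "c' < (SUP t. ?p t)"
    using assms(2,3) by (simp add: output_prob_def)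
  then obtain t0 where t0: "c' < ?p t0"
    by (subst (asm) less_cSUP_iff) (auto intro!: bdd_aboveI[of _ 1])
  have eq: "ennreal (?p t) = ?I t" for t
    unfolding measure_pmf.emeasure_eq_measure[symmetric]
    by (simp add: weak_run_def weak_oracle_eq_answers_pmf[of n g d, OF g] run_eq_steps emeasure_steps_Halted)
  have "ennreal c' \<le> ?I t" if "t0 \<le> t" for t
  proof -
    have "ennreal c' \<le> ?I t0"
      unfolding eq[symmetric] using t0 by (intro ennreal_leI) simp
    also have "\<dots> \<le> ?I t"
      by (intro nn_integral_measure_pmf_mono reward_mono_time that)
    finally show ?thesis .
  qed
  then show ?thesis by blast
qed

lemma reward_le_expected_queries:
  assumes g: "\<And>e. e \<notin> point_pairs n \<Longrightarrow> g e = d e"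
  shows "(\<integral>\<^sup>+F. reward A never (\<lambda>_ _. 1) (\<lambda>_. 0) F t [] \<partial>answers_pmf \<delta> d adv (point_pairs n) g)
    \<le> expected_queries n \<delta> (\<lambda>x y. d {x, y}) adv A"
proof -
  have "(\<integral>\<^sup>+F. reward A never (\<lambda>_ _. 1) (\<lambda>_. 0) F t [] \<partial>answers_pmf \<delta> d adv (point_pairs n) g) =
    (\<integral>\<^sup>+s. of_nat (num_queries s) \<partial>weak_run n \<delta> (\<lambda>x y. d {x, y}) adv A t)"
    by (simp add: weak_run_def weak_oracle_eq_answers_pmf[of n g d, OF g] run_eq_steps nn_integral_steps_num_queries)
  also have "\<dots> \<le> expected_queries n \<delta> (\<lambda>x y. d {x, y}) adv A"
    unfolding expected_queries_def by (rule SUP_upper) simp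
  finally show ?thesis .
qed

section \<open>Cluster metrics\<close>

text \<open>A function of the unordered pair. Outside \<open>point_pairs n\<close> its value is
  independent of \<open>l\<close>, so one table \<open>g\<close> serves all labellings.\<close>

definition cluster_dist :: "nat \<Rightarrow> real \<Rightarrow> (nat \<Rightarrow> nat) \<Rightarrow> answers" where
  "cluster_dist n s l e =
     (if card e \<le> 1 then 0 else if e \<in> point_pairs n \<and> (\<exists>c. l ` e = {c}) then s else 1)"

text \<open>The adversary answers a corrupted pair with the other one of the two possible distances.\<close>

definition swapped_dist :: "nat \<Rightarrow> real \<Rightarrow> (nat \<Rightarrow> nat) \<Rightarrow> answers" where
  "swapped_dist n s l e = 1 + s - cluster_dist n s l e"

lemma cluster_dist_pair:
  "x < n \<Longrightarrow> y < n \<Longrightarrow> cluster_dist n s l {x, y} = (if x = y then 0 else if l x = l y then s else 1)"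
  by (auto simp: cluster_dist_def point_pairs_def card_insert_if)

text \<open>An ultrametric: if \<open>x\<close> and \<open>z\<close> lie in different clusters, then
  any \<open>y\<close> is in a different cluster from one of them.\<close>

lemma Metric_space_cluster_dist:
  assumes "0 < s" "s \<le> 1"
  shows "Metric_space {..<n} (\<lambda>x y. cluster_dist n s l {x, y})"
proof
  show "0 \<le> cluster_dist n s l {x, y}" for x y
    using assms by (simp add: cluster_dist_def)
  show "cluster_dist n s l {x, y} = cluster_dist n s l {y, x}" for x y
    by (simp add: insert_commute)
qed (use assms in \<open>auto simp: cluster_dist_pair\<close>)

lemma cluster_dist_outside:
  "e \<notin> point_pairs n \<Longrightarrow> cluster_dist n s l e = cluster_dist n s l' e"
  by (simp add: cluster_dist_def)

lemma finite_center_sets: "finite (center_sets {..<n} k)"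
  unfolding center_sets_def by (rule finite_subset[of _ "Pow {..<n}"]) auto

text \<open>One representative per cluster, padded to exactly \<open>k\<close> centers, serves every
  point within distance \<open>s\<close>.\<close>

lemma kmeans_opt_cluster_dist_le:
  assumes s: "0 < s" and "card (l ` {..<n}) \<le> k" "k \<le> n"
  shows "kmeans_opt (\<lambda>x y. cluster_dist n s l {x, y}) {..<n} k \<le> real n * s\<^sup>2"
proof -
  let ?d = "\<lambda>x y. cluster_dist n s l {x, y}"
  define rep where "rep c = (SOME x. x < n \<and> l x = c)" for c
  have rep: "rep (l x) < n \<and> l (rep (l x)) = l x" if "x < n" for x
    unfolding rep_def by (rule someI[of _ x]) (use that in auto)
  define R where "R = rep ` l ` {..<n}"
  have "card R \<le> k"
    unfolding R_def using card_image_le[of "l ` {..<n}" rep] assms by simp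
  moreover have "R \<subseteq> {..<n}"
    using rep by (auto simp: R_def)
  ultimately obtain C where C: "R \<subseteq> C" "C \<subseteq> {..<n}" "card C = k"
    using assms exists_subset_between[of R k "{..<n}"] by (auto simp: R_def)
  have fin: "finite C" using C finite_subset by blast
  have "kmeans_opt ?d {..<n} k \<le> kmeans_cost ?d {..<n} C"
    unfolding kmeans_opt_def using C finite_center_sets by (intro Min_le) (auto simp: center_sets_def)
  also have "\<dots> \<le> (\<Sum>x<n. s\<^sup>2)"
    unfolding kmeans_cost_def
  proof (rule sum_mono)
    fix x assume x: "x \<in> {..<n}"
    then have "rep (l x) \<in> C"
      using C by (auto simp: R_def)
    then have "Min ((\<lambda>c. (?d x c)\<^sup>2) ` C) \<le> (?d x (rep (l x)))\<^sup>2"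
      using fin by (intro Min_le) auto
    also have "\<dots> \<le> s\<^sup>2"
      using rep[of x] x s by (simp add: cluster_dist_pair)
    finally show "Min ((\<lambda>c. (?d x c)\<^sup>2) ` C) \<le> s\<^sup>2" .
  qed
  finally show ?thesis by simp
qed

text \<open>A single point of a missed cluster already costs 1, more than \<alpha> times the
  optimum.\<close>

lemma approx_solution_hits_cluster:
  assumes s: "0 < s" and small: "\<alpha> * (real n * s\<^sup>2) < 1" and \<alpha>: "0 \<le> \<alpha>"
    and "card (l ` {..<n}) \<le> k" "k \<le> n" "0 < k"
    and C: "C \<in> approx_solutions \<alpha> (\<lambda>x y. cluster_dist n s l {x, y}) {..<n} k"
    and x: "x < n"
  shows "\<exists>c\<in>C. l c = l x"
proof (rule ccontr)
  let ?d = "\<lambda>x y. cluster_dist n s l {x, y}"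
  assume no: "\<not> ?thesis"
  have C': "C \<subseteq> {..<n}" "card C = k"
    using C by (auto simp: approx_solutions_def center_sets_def)
  then have fin: "finite C" and ne: "C \<noteq> {}"
    using assms finite_subset by (blast, force)
  have "(?d x c)\<^sup>2 = 1" if "c \<in> C" for c
    using no that C' x by (cases "c = x") (force simp: cluster_dist_pair)+
  then have "(\<lambda>c. (?d x c)\<^sup>2) ` C = {1}"
    using ne by auto
  then have "1 = Min ((\<lambda>c. (?d x c)\<^sup>2) ` C)" by simp
  also have "\<dots> \<le> kmeans_cost ?d {..<n} C"
    unfolding kmeans_cost_def using x fin ne
    by (intro member_le_sum) auto
  also have "\<dots> \<le> \<alpha> * kmeans_opt ?d {..<n} k"
    using C by (simp add: approx_solutions_def)
  also have "\<dots> \<le> \<alpha> * (real n * s\<^sup>2)"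
    using \<alpha> assms by (intro mult_left_mono kmeans_opt_cluster_dist_le) auto
  finally show False using small by simp
qed

section \<open>Truncating a run\<close>

text \<open>A stop is credited with 1, at least what any continuation can earn.\<close>

lemma reward_never_le_stopped:
  assumes "\<And>C. \<omega> C \<le> 1"
  shows "reward A never (\<lambda>_ _. 0) \<omega> F t h \<le> reward A stp (\<lambda>h e. of_bool (stp h e)) \<omega> F t h"
proof (induction t arbitrary: h)
  case (Suc t)
  show ?case
    unfolding reward.simps
    by (intro nn_integral_measure_pmf_mono)
      (auto split: action.split intro: Suc reward_output_le assms)
qed simp

definition touches :: "nat \<Rightarrow> history \<Rightarrow> real" where
  "touches x h = real (length (filter (\<lambda>((i, j), _). x \<in> {i, j}) h))"

lemma touches_Nil [simp]: "touches x [] = 0"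
  by (simp add: touches_def)

lemma touches_snoc [simp]: "touches x (h @ [((i, j), v)]) = touches x h + of_bool (x \<in> {i, j})"
  by (simp add: touches_def)

lemma touches_nonneg [simp]: "0 \<le> touches x h"
  by (simp add: touches_def)

text \<open>The \<open>+ 1\<close> counts the query under consideration: the run is cut off before
  the answer that would bring the count at \<open>x\<close> to \<open>M\<close>.\<close>

definition saturated :: "nat \<Rightarrow> real \<Rightarrow> history \<Rightarrow> nat set \<Rightarrow> bool" where
  "saturated x M h e \<longleftrightarrow> x \<in> e \<and> M \<le> touches x h + 1"

text \<open>Markov's inequality: a stop requires \<open>M\<close> queries at \<open>x\<close>, so it
  has probability at most their expected number over \<open>M\<close>. Past queries are included to
  make the induction work.\<close>

lemma reward_saturated_le:
  assumes M: "0 < M"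
  shows "reward A (saturated x M) (\<lambda>h e. of_bool (saturated x M h e)) \<omega> F t h \<le>
    reward A never (\<lambda>_ _. 0) \<omega> F t h +
    ennreal (1 / M) * (ennreal (touches x h) + reward A never (\<lambda>_ e. of_bool (x \<in> e)) (\<lambda>_. 0) F t h)"
proof (induction t arbitrary: h)
  case (Suc t)
  let ?c = "ennreal (1 / M)"
  let ?o = "\<lambda>a. case a of
      Query i j \<Rightarrow> reward A never (\<lambda>_ _. 0) \<omega> F t (h @ [((i, j), F {i, j})]) | Output C \<Rightarrow> \<omega> C"
  let ?q = "\<lambda>a. case a of
      Query i j \<Rightarrow> of_bool (x \<in> {i, j}) +
        reward A never (\<lambda>_ e. of_bool (x \<in> e)) (\<lambda>_. 0) F t (h @ [((i, j), F {i, j})]) | Output C \<Rightarrow> 0"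
  have stop: "1 \<le> r + ?c * (ennreal (touches x h) + (1 + r'))" if "M \<le> touches x h + 1" for r r'
  proof -
    have "1 = ?c * ennreal M"
      using M by (simp flip: ennreal_mult)
    also have "\<dots> \<le> ?c * (ennreal (touches x h) + 1)"
      using that by (intro mult_left_mono) (auto simp flip: ennreal_1 ennreal_plus intro!: ennreal_leI)
    also have "\<dots> \<le> ?c * (ennreal (touches x h) + (1 + r'))"
      by (intro mult_left_mono add_left_mono) auto
    also have "\<dots> \<le> r + ?c * (ennreal (touches x h) + (1 + r'))"
      by simp
    finally show ?thesis .
  qed
  have "reward A (saturated x M) (\<lambda>h e. of_bool (saturated x M h e)) \<omega> F (Suc t) h \<le>
      (\<integral>\<^sup>+a. ?o a + ?c * (ennreal (touches x h) + ?q a) \<partial>measure_pmf (A h))"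
    unfolding reward.simps
  proof (intro nn_integral_measure_pmf_mono)
    fix a
    show "(case a of Query i j \<Rightarrow> of_bool (saturated x M h {i, j}) +
        (if saturated x M h {i, j} then 0
         else reward A (saturated x M) (\<lambda>h e. of_bool (saturated x M h e)) \<omega> F t (h @ [((i, j), F {i, j})]))
      | Output C \<Rightarrow> \<omega> C) \<le> ?o a + ?c * (ennreal (touches x h) + ?q a)"
    proof (cases a)
      case (Query i j)
      show ?thesis
      proof (cases "saturated x M h {i, j}")
        case True
        then show ?thesis
          using Query stop by (auto simp: saturated_def)
      next
        case False
        have eq: "ennreal (touches x (h @ [((i, j), F {i, j})])) = ennreal (touches x h) + of_bool (x \<in> {i, j})"
          by (simp add: ennreal_plus)
        from False Query Suc[of "h @ [((i, j), F {i, j})]"] show ?thesis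
          unfolding eq by (simp add: ac_simps)
      qed
    qed simp
  qed
  also have "\<dots> = reward A never (\<lambda>_ _. 0) \<omega> F (Suc t) h +
    ?c * (ennreal (touches x h) + reward A never (\<lambda>_ e. of_bool (x \<in> e)) (\<lambda>_. 0) F (Suc t) h)"
    by (simp add: nn_integral_add nn_integral_cmult cong: action.case_cong)
  finally show ?case .
qed simp

text \<open>The cutoff bounds the answered queries at \<open>x\<close> on every path, not only on
  average; again past queries are carried along for the induction.\<close>

lemma reward_unsaturated_le:
  assumes "touches x h \<le> M"
  shows "ennreal (touches x h) +
    reward A (saturated x M) (\<lambda>h e. of_bool (x \<in> e \<and> \<not> saturated x M h e)) (\<lambda>_. 0) F t h \<le> ennreal M"
  using assms
proof (induction t arbitrary: h)
  case 0
  then show ?case by (simp add: ennreal_leI)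
next
  case (Suc t)
  let ?r = "reward A (saturated x M) (\<lambda>h e. of_bool (x \<in> e \<and> \<not> saturated x M h e)) (\<lambda>_. 0) F"
  have "ennreal (touches x h) + ?r (Suc t) h = (\<integral>\<^sup>+a. ennreal (touches x h) + (case a of
         Query i j \<Rightarrow> of_bool (x \<in> {i, j} \<and> \<not> saturated x M h {i, j}) +
           (if saturated x M h {i, j} then 0 else ?r t (h @ [((i, j), F {i, j})]))
       | Output C \<Rightarrow> 0) \<partial>measure_pmf (A h))"
    by (simp add: nn_integral_add)
  also have "\<dots> \<le> (\<integral>\<^sup>+a. ennreal M \<partial>measure_pmf (A h))"
  proof (intro nn_integral_measure_pmf_mono)
    fix a
    show "ennreal (touches x h) + (case a of
         Query i j \<Rightarrow> of_bool (x \<in> {i, j} \<and> \<not> saturated x M h {i, j}) +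
           (if saturated x M h {i, j} then 0 else ?r t (h @ [((i, j), F {i, j})]))
       | Output C \<Rightarrow> 0) \<le> ennreal M"
    proof (cases a)
      case (Query i j)
      show ?thesis
      proof (cases "saturated x M h {i, j}")
        case True
        with Query Suc.prems show ?thesis by (simp add: ennreal_leI)
      next
        case False
        have eq: "ennreal (touches x (h @ [((i, j), F {i, j})])) = ennreal (touches x h) + of_bool (x \<in> {i, j})"
          by (simp add: ennreal_plus)
        have "touches x (h @ [((i, j), F {i, j})]) \<le> M"
          using False Suc.prems by (auto simp: saturated_def)
        from Suc.IH[OF this] show ?thesis
          using Query False unfolding eq by (simp add: ac_simps)
      qed
    qed (use Suc.prems in \<open>simp add: ennreal_leI\<close>)
  qed
  finally show ?case by simp
qed

section \<open>Random answers for a cluster metric\<close>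

definition cluster_answers :: "nat \<Rightarrow> real \<Rightarrow> real \<Rightarrow> (nat \<Rightarrow> nat) \<Rightarrow> answers pmf" where
  "cluster_answers n \<delta> s l =
     answers_pmf \<delta> (cluster_dist n s l) (swapped_dist n s l) (point_pairs n) (cluster_dist n s (\<lambda>_. 0))"

text \<open>Replacing 3/4 by 37/50 pays for the passage to a finite horizon.\<close>

lemma solves_imp_reward:
  assumes solves: "solves_kmeans \<alpha> n k \<delta> A" and s: "0 < s" "s \<le> 1"
    and G: "approx_solutions \<alpha> (\<lambda>x y. cluster_dist n s l {x, y}) {..<n} k \<subseteq> G"
  shows "\<exists>t0. \<forall>t\<ge>t0. ennreal (37/50) \<le>
    (\<integral>\<^sup>+F. reward A never (\<lambda>_ _. 0) (\<lambda>C. of_bool (C \<in> G)) F t [] \<partial>cluster_answers n \<delta> s l)"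
proof -
  let ?G = "approx_solutions \<alpha> (\<lambda>x y. cluster_dist n s l {x, y}) {..<n} k"
  have "3/4 \<le> output_prob n \<delta> (\<lambda>x y. cluster_dist n s l {x, y}) (swapped_dist n s l) A ?G"
    using solves Metric_space_cluster_dist[OF s, of n l] by (auto simp: solves_kmeans_def)
  then have "\<exists>t0. \<forall>t\<ge>t0. ennreal (37/50) \<le>
    (\<integral>\<^sup>+F. reward A never (\<lambda>_ _. 0) (\<lambda>C. of_bool (C \<in> ?G)) F t [] \<partial>cluster_answers n \<delta> s l)"
    unfolding cluster_answers_def
    by (intro output_prob_ge_imp_reward[where c = "3/4"]) (auto intro: cluster_dist_outside)
  then obtain t0 where t0: "\<And>t. t0 \<le> t \<Longrightarrow> ennreal (37/50) \<le>
    (\<integral>\<^sup>+F. reward A never (\<lambda>_ _. 0) (\<lambda>C. of_bool (C \<in> ?G)) F t [] \<partial>cluster_answers n \<delta> s l)"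
    by blast
  show ?thesis
  proof (intro exI[of _ t0] allI impI)
    fix t assume "t0 \<le> t"
    note t0[OF this]
    also have "(\<integral>\<^sup>+F. reward A never (\<lambda>_ _. 0) (\<lambda>C. of_bool (C \<in> ?G)) F t [] \<partial>cluster_answers n \<delta> s l)
      \<le> (\<integral>\<^sup>+F. reward A never (\<lambda>_ _. 0) (\<lambda>C. of_bool (C \<in> G)) F t [] \<partial>cluster_answers n \<delta> s l)"
      using G by (intro nn_integral_measure_pmf_mono reward_mono) auto
    finally show "ennreal (37/50) \<le>
      (\<integral>\<^sup>+F. reward A never (\<lambda>_ _. 0) (\<lambda>C. of_bool (C \<in> G)) F t [] \<partial>cluster_answers n \<delta> s l)" .
  qed
qed

lemma cluster_reward_le_expected_queries:
  "(\<integral>\<^sup>+F. reward A never (\<lambda>_ _. 1) (\<lambda>_. 0) F t [] \<partial>cluster_answers n \<delta> s l)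
    \<le> expected_queries n \<delta> (\<lambda>x y. cluster_dist n s l {x, y}) (swapped_dist n s l) A"
  unfolding cluster_answers_def
  by (intro reward_le_expected_queries cluster_dist_outside)

text \<open>On \<open>D\<close> the true answer for one labelling is the corrupted answer for the
  other. The choice \<open>\<kappa> = 1/100\<close> gives the factor
  \<open>2 / \<kappa> = 200\<close>.\<close>

lemma near_cluster_reward:
  assumes "0 < \<delta>" "\<delta> < 1/2"
    and D: "\<And>e. e \<in> D \<Longrightarrow> cluster_dist n s l e = 1 \<and> cluster_dist n s l' e = s"
    and notD: "\<And>e. e \<notin> D \<Longrightarrow> cluster_dist n s l' e = cluster_dist n s l e"
  shows "near
      (\<integral>\<^sup>+F. reward A stp (\<lambda>h e. of_bool (stp h e)) (\<lambda>C. of_bool (C \<in> G)) F t [] \<partial>cluster_answers n \<delta> s l)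
      (\<integral>\<^sup>+F. reward A stp (\<lambda>h e. of_bool (stp h e)) (\<lambda>C. of_bool (C \<in> G)) F t [] \<partial>cluster_answers n \<delta> s l')
      (ennreal (1/100) + ennreal (200 * (1 - 2 * \<delta>)\<^sup>2) *
        (\<integral>\<^sup>+F. reward A stp (\<lambda>h e. of_bool (e \<in> D \<and> \<not> stp h e)) (\<lambda>_. 0) F t [] \<partial>cluster_answers n \<delta> s l))"
  using near_reward_start[OF assms(1,2), where \<kappa> = "1/100" and R = "point_pairs n" and D = D and
      d = "cluster_dist n s l" and d' = "cluster_dist n s l'" and adv = "swapped_dist n s l" and
      adv' = "swapped_dist n s l'" and g = "cluster_dist n s (\<lambda>_. 0)" and h = "[]"]
  using D notD by (simp add: cluster_answers_def swapped_dist_def finite_point_pairs mult.commute)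

section \<open>Few centers\<close>

text \<open>Moving an isolated point into cluster \<open>j\<close> changes only its distances to the
  members of \<open>j\<close>; the image condition in \<open>D\<close> says that the other endpoint
  has label \<open>j\<close>.\<close>

lemma cluster_dist_isolated:
  assumes x: "x < n" and l: "\<And>y. y < n \<Longrightarrow> y \<noteq> x \<Longrightarrow> l y \<noteq> l x" and j: "j \<noteq> l x"
    and D: "D = {e \<in> point_pairs n. x \<in> e \<and> l ` (e - {x}) = {j}}"
  shows "e \<in> D \<Longrightarrow> cluster_dist n s l e = 1 \<and> cluster_dist n s (l(x := j)) e = s"
    and "e \<notin> D \<Longrightarrow> cluster_dist n s (l(x := j)) e = cluster_dist n s l e"
proof -
  have pair: "e \<in> D \<longleftrightarrow> l y = j" "cluster_dist n s l e = 1"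
      "cluster_dist n s (l(x := j)) e = (if l y = j then s else 1)"
    if "e = {x, y}" "y < n" "y \<noteq> x" for y
  proof -
    have "l ` (e - {x}) = {l y}" using that by auto
    then show "e \<in> D \<longleftrightarrow> l y = j"
      using that x by (auto simp: D point_pairs_def card_insert_if)
    show "cluster_dist n s l e = 1" "cluster_dist n s (l(x := j)) e = (if l y = j then s else 1)"
      using that x l[of y] by (auto simp: cluster_dist_pair)
  qed
  have obtain_y: "\<exists>y. e = {x, y} \<and> y < n \<and> y \<noteq> x" if "e \<in> point_pairs n" "x \<in> e"
    using that by (auto simp: point_pairs_def card_2_iff)
  show "cluster_dist n s l e = 1 \<and> cluster_dist n s (l(x := j)) e = s" if "e \<in> D"
    using obtain_y pair that D by auto
  show "cluster_dist n s (l(x := j)) e = cluster_dist n s l e" if "e \<notin> D"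
  proof (cases "e \<in> point_pairs n")
    case True
    show ?thesis
    proof (cases "x \<in> e")
      case False
      then have "(l(x := j)) ` e = l ` e" by (intro image_cong) auto
      then show ?thesis by (simp add: cluster_dist_def)
    qed (use obtain_y[OF True] pair that in auto)
  qed (simp add: cluster_dist_def)
qed

text \<open>Exchanging the label \<open>\<sigma> x\<close> with an independent label \<open>j\<close> is an involution.\<close>

lemma sum_resample_label:
  fixes g :: "(nat \<Rightarrow> nat) \<Rightarrow> nat \<Rightarrow> ennreal" and K :: nat
  assumes "x \<in> I"
  defines "S \<equiv> PiE I (\<lambda>_. {..<K})"
  shows "of_nat K * (\<Sum>\<sigma>\<in>S. g (\<sigma>(x := c)) (\<sigma> x)) = (\<Sum>\<sigma>\<in>S. \<Sum>j<K. g (\<sigma>(x := c)) j)"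
proof -
  have "(\<Sum>\<sigma>\<in>S. \<Sum>j<K. g (\<sigma>(x := c)) j) = (\<Sum>(\<sigma>, j)\<in>S \<times> {..<K}. g (\<sigma>(x := c)) j)"
    by (simp add: sum.cartesian_product)
  also have "\<dots> = (\<Sum>(\<sigma>, j)\<in>S \<times> {..<K}. g (\<sigma>(x := c)) (\<sigma> x))"
    using assms(1)
    by (intro sum.reindex_bij_witness[where i = "\<lambda>(\<sigma>, j). (\<sigma>(x := j), \<sigma> x)"
          and j = "\<lambda>(\<sigma>, j). (\<sigma>(x := j), \<sigma> x)"])
      (auto simp: S_def PiE_iff extensional_def)
  also have "\<dots> = (\<Sum>\<sigma>\<in>S. \<Sum>j<K. g (\<sigma>(x := c)) (\<sigma> x))"
    by (rule sum.cartesian_product[symmetric])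
  also have "\<dots> = of_nat K * (\<Sum>\<sigma>\<in>S. g (\<sigma>(x := c)) (\<sigma> x))"
    by (simp add: sum_distrib_left)
  finally show ?thesis ..
qed

lemma eventually_all_finite:
  assumes "finite I" "\<And>i. i \<in> I \<Longrightarrow> \<exists>t0::nat. \<forall>t\<ge>t0. P i t"
  shows "\<exists>t. \<forall>i\<in>I. P i t"
proof -
  have "\<forall>\<^sub>F t in sequentially. \<forall>i\<in>I. P i t"
    using assms by (intro eventually_ball_finite) (auto simp: eventually_sequentially)
  then show ?thesis
    using eventually_happens' sequentially_bot by blast
qed

lemma few_centers_bound:
  assumes \<alpha>: "0 \<le> \<alpha>" and s: "0 < s" "s \<le> 1" "\<alpha> * (real n * s\<^sup>2) < 1"
    and kn: "2 \<le> k" "k < n" "3 * k \<le> 2 * n" and \<delta>: "0 < \<delta>" "\<delta> < 1/2"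
    and solves: "solves_kmeans \<alpha> n k \<delta> A" and B: "0 \<le> B"
    and queries: "\<And>l t. (\<integral>\<^sup>+F. reward A never (\<lambda>_ _. 1) (\<lambda>_. 0) F t [] \<partial>cluster_answers n \<delta> s l) \<le> ennreal B"
  shows "real n * real (k - 1) / (1000000 * (1 - 2 * \<delta>)\<^sup>2) \<le> B"
proof (rule ccontr)
  define K where "K = k - 1"
  \<comment> \<open>Chosen so that \<open>M / K\<close> queries, the average share of one cluster,
    cause an error of 1/100 only.\<close>
  define M where "M = real K / (20000 * (1 - 2 * \<delta>)\<^sup>2)"
  define S where "S = PiE {..<n} (\<lambda>_. {..<K})"
  assume "\<not> ?thesis"
  moreover have K: "0 < K" "K < k" "k = Suc K"
    using kn by (auto simp: K_def)
  have \<epsilon>: "0 < (1 - 2 * \<delta>)\<^sup>2"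
    using \<delta> by simp
  have M: "0 < M"
    unfolding M_def using K \<epsilon> by simp
  have kM: "200 * (1 - 2 * \<delta>)\<^sup>2 * M = real K / 100"
    unfolding M_def using \<epsilon> by simp
  have "real n * real (k - 1) / (1000000 * (1 - 2 * \<delta>)\<^sup>2) = real n * M / 50"
    unfolding M_def K_def by simp
  ultimately have BM: "50 * B < real n * M" by simp
  have S: "finite S" "0 < card S"
    using K by (auto simp: S_def finite_PiE card_PiE)

  \<comment> \<open>The label \<open>K\<close> occurs only at \<open>x\<close> in
    \<open>\<sigma>(x := K)\<close>, so a correct output contains \<open>x\<close>. Membership in
    \<open>center_sets\<close> ensures that an output lies in \<open>G x\<close> for at most
    \<open>k\<close> points.\<close>
  define G where "G x = {C \<in> center_sets {..<n} k. x \<in> C}" for x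
  have "\<exists>t0. \<forall>t\<ge>t0. ennreal (37/50) \<le> (\<integral>\<^sup>+F. reward A never (\<lambda>_ _. 0) (\<lambda>C. of_bool (C \<in> G x)) F t []
      \<partial>cluster_answers n \<delta> s (\<sigma>(x := K)))" if "(\<sigma>, x) \<in> S \<times> {..<n}" for \<sigma> x
  proof (rule solves_imp_reward[OF solves s(1,2)])
    let ?l = "\<sigma>(x := K)"
    note \<sigma>x = that
    have "card (?l ` {..<n}) \<le> card {..K}"
      using that by (intro card_mono) (auto simp: S_def PiE_iff less_imp_le)
    then have card: "card (?l ` {..<n}) \<le> k"
      using K by simp
    show "approx_solutions \<alpha> (\<lambda>u v. cluster_dist n s ?l {u, v}) {..<n} k \<subseteq> G x"
    proof
      fix C assume C: "C \<in> approx_solutions \<alpha> (\<lambda>u v. cluster_dist n s ?l {u, v}) {..<n} k"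
      then obtain c where c: "c \<in> C" "?l c = ?l x"
        using approx_solution_hits_cluster[OF s(1,3) \<alpha> card _ _ C, of x] kn \<sigma>x by auto
      have C': "C \<in> center_sets {..<n} k"
        using C by (simp add: approx_solutions_def)
      then have "c < n"
        using c by (auto simp: center_sets_def)
      then have "c = x"
        using c that by (auto simp: S_def PiE_iff split: if_splits)
      with c C' show "C \<in> G x" by (simp add: G_def)
    qed
  qed
  then obtain t where succ: "\<And>\<sigma> x. \<sigma> \<in> S \<Longrightarrow> x < n \<Longrightarrow>
      ennreal (37/50) \<le> (\<integral>\<^sup>+F. reward A never (\<lambda>_ _. 0) (\<lambda>C. of_bool (C \<in> G x)) F t []
        \<partial>cluster_answers n \<delta> s (\<sigma>(x := K)))"
    using eventually_all_finite[of "S \<times> {..<n}" "\<lambda>(\<sigma>, x) t. ennreal (37/50) \<le>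
      (\<integral>\<^sup>+F. reward A never (\<lambda>_ _. 0) (\<lambda>C. of_bool (C \<in> G x)) F t [] \<partial>cluster_answers n \<delta> s (\<sigma>(x := K)))"] S
    by fastforce

  \<comment> \<open>\<open>out\<close> and \<open>tou\<close> are evaluated at \<sigma>, but
    \<open>num\<close> will be evaluated at the isolated labelling \<open>\<sigma>(x := K)\<close>,
    which carries no information on \<open>\<sigma> x\<close>.\<close>
  define out where "out \<sigma> x = (\<integral>\<^sup>+F. reward A never (\<lambda>_ _. 0) (\<lambda>C. of_bool (C \<in> G x)) F t []
    \<partial>cluster_answers n \<delta> s \<sigma>)" for \<sigma> x
  define tou where "tou \<sigma> x = (\<integral>\<^sup>+F. reward A never (\<lambda>_ e. of_bool (x \<in> e)) (\<lambda>_. 0) F t []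
    \<partial>cluster_answers n \<delta> s \<sigma>)" for \<sigma> x
  define D where "D l x j = {e \<in> point_pairs n. x \<in> e \<and> l ` (e - {x}) = {j}}" for l :: "nat \<Rightarrow> nat" and x j
  define num where "num x l j = (\<integral>\<^sup>+F. reward A (saturated x M)
      (\<lambda>h e. of_bool (e \<in> D l x j \<and> \<not> saturated x M h e)) (\<lambda>_. 0) F t []
    \<partial>cluster_answers n \<delta> s l)" for l x j
  let ?k = "ennreal (200 * (1 - 2 * \<delta>)\<^sup>2)"

  \<comment> \<open>Success in the isolated labelling is transferred to \<sigma> for the truncated
    run; the truncation is then undone by Markov's inequality.\<close>
  have one: "ennreal (37/50) \<le> out \<sigma> x + ennreal (1 / M) * tou \<sigma> x + (ennreal (1/100) + ?k * num x (\<sigma>(x := K)) (\<sigma> x))"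
    if "\<sigma> \<in> S" "x < n" for \<sigma> x
  proof -
    let ?l = "\<sigma>(x := K)" and ?st = "saturated x M"
    let ?val = "\<lambda>l. \<integral>\<^sup>+F. reward A ?st (\<lambda>h e. of_bool (?st h e)) (\<lambda>C. of_bool (C \<in> G x)) F t []
      \<partial>cluster_answers n \<delta> s l"
    have l: "?l y \<noteq> ?l x" if "y < n" "y \<noteq> x" for y
      using that \<open>\<sigma> \<in> S\<close> by (auto simp: S_def PiE_iff)
    have j: "\<sigma> x \<noteq> ?l x"
      using that by (auto simp: S_def PiE_iff)
    have "ennreal (37/50) \<le> (\<integral>\<^sup>+F. reward A never (\<lambda>_ _. 0) (\<lambda>C. of_bool (C \<in> G x)) F t []
        \<partial>cluster_answers n \<delta> s ?l)"
      using succ that by blast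
    also have "\<dots> \<le> ?val ?l"
      by (intro nn_integral_measure_pmf_mono reward_never_le_stopped) simp
    also have "\<dots> \<le> ?val \<sigma> + (ennreal (1/100) + ?k * num x ?l (\<sigma> x))"
      using near_cluster_reward[OF \<delta>, of "D ?l x (\<sigma> x)" n s ?l \<sigma> A ?st "G x" t]
        cluster_dist_isolated[where x = x and n = n and l = ?l and j = "\<sigma> x" and D = "D ?l x (\<sigma> x)" and s = s,
          OF \<open>x < n\<close> l j D_def]
      by (simp add: near_def num_def)
    also have "?val \<sigma> \<le> (\<integral>\<^sup>+F. reward A never (\<lambda>_ _. 0) (\<lambda>C. of_bool (C \<in> G x)) F t [] +
        ennreal (1 / M) * reward A never (\<lambda>_ e. of_bool (x \<in> e)) (\<lambda>_. 0) F t [] \<partial>cluster_answers n \<delta> s \<sigma>)"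
      using reward_saturated_le[OF M, of A x _ _ t "[]"] by (intro nn_integral_measure_pmf_mono) simp
    also have "\<dots> = out \<sigma> x + ennreal (1 / M) * tou \<sigma> x"
      by (simp add: out_def tou_def nn_integral_add nn_integral_cmult)
    finally show ?thesis
      by (simp add: fun_upd_def)
  qed

  \<comment> \<open>Totals over points, clusters and labellings\<close>
  have out_sum: "(\<Sum>x<n. out \<sigma> x) \<le> ennreal (real k)" for \<sigma>
  proof -
    have "(\<Sum>x<n. of_bool (C \<in> G x)) \<le> ennreal (real k)" for C
    proof (cases "C \<in> center_sets {..<n} k")
      case True
      then have "{..<n} \<inter> {x. C \<in> G x} = C" "card C = k"
        by (auto simp: G_def center_sets_def)
      then show ?thesis
        by (simp add: sum_of_bool_eq ennreal_of_nat_eq_real_of_nat)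
    qed (simp add: G_def)
    then have "(\<integral>\<^sup>+F. (\<Sum>x<n. reward A never (\<lambda>_ _. 0) (\<lambda>C. of_bool (C \<in> G x)) F t [])
        \<partial>cluster_answers n \<delta> s \<sigma>) \<le> (\<integral>\<^sup>+F. ennreal (real k) \<partial>cluster_answers n \<delta> s \<sigma>)"
      by (intro nn_integral_measure_pmf_mono) (simp add: reward_sum reward_output_le)
    then show ?thesis
      by (simp add: out_def nn_integral_sum)
  qed

  have tou_sum: "(\<Sum>x<n. tou \<sigma> x) \<le> ennreal (2 * B)" for \<sigma>
  proof -
    have two: "(\<Sum>x<n. of_bool (x \<in> {i, j})) \<le> (2 * 1 :: ennreal)" for i j
    proof -
      have "card ({..<n} \<inter> {x. x \<in> {i, j}}) \<le> card {i, j}"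
        by (intro card_mono) auto
      also have "\<dots> \<le> 2"
        by (simp add: card_insert_if)
      finally have "real (card ({..<n} \<inter> {x. x \<in> {i, j}})) \<le> 2"
        by simp
      then show ?thesis
        by (subst sum_of_bool_eq) (auto simp: ennreal_of_nat_eq_real_of_nat simp flip: ennreal_numeral intro!: ennreal_leI)
    qed
    have "(\<Sum>x<n. tou \<sigma> x) = (\<integral>\<^sup>+F. reward A never (\<lambda>_ e. \<Sum>x<n. of_bool (x \<in> e)) (\<lambda>_. \<Sum>x<n. 0) F t []
        \<partial>cluster_answers n \<delta> s \<sigma>)"
      unfolding tou_def by (rule nn_integral_reward_sum) simp
    also have "\<dots> \<le> (\<integral>\<^sup>+F. reward A never (\<lambda>_ _. 2 * 1) (\<lambda>_. 2 * 0) F t [] \<partial>cluster_answers n \<delta> s \<sigma>)"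
      using two by (intro nn_integral_measure_pmf_mono reward_mono) simp_all
    also have "\<dots> = 2 * (\<integral>\<^sup>+F. reward A never (\<lambda>_ _. 1) (\<lambda>_. 0) F t [] \<partial>cluster_answers n \<delta> s \<sigma>)"
      unfolding reward_cmult by (simp add: nn_integral_cmult)
    also have "\<dots> \<le> 2 * ennreal B"
      by (intro mult_left_mono queries) simp
    finally show ?thesis
      using B by (simp add: ennreal_mult)
  qed

  \<comment> \<open>For different \<open>j\<close> the sets \<open>D l x j\<close> are disjoint and
    consist of pairs at \<open>x\<close>, so the truncation bounds their total by
    \<open>M\<close>.\<close>
  have num_sum: "(\<Sum>j<K. num x l j) \<le> ennreal M" for x l
  proof -
    have disj: "(\<Sum>j<K. of_bool (e \<in> D l x j \<and> \<not> saturated x M h e)) \<le> (of_bool (x \<in> e \<and> \<not> saturated x M h e) :: ennreal)" for h e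
    proof (cases "\<exists>j<K. e \<in> D l x j \<and> \<not> saturated x M h e")
      case True
      then obtain j where j: "j < K" "e \<in> D l x j" "\<not> saturated x M h e" by blast
      then have "e \<in> D l x i \<Longrightarrow> i = j" for i
        by (simp add: D_def)
      with j have "{..<K} \<inter> {j. e \<in> D l x j \<and> \<not> saturated x M h e} = {j}"
        by blast
      moreover have "x \<in> e"
        using j by (simp add: D_def)
      ultimately show ?thesis
        using j by (simp add: sum_of_bool_eq)
    next
      case False
      then have "(\<Sum>j<K. of_bool (e \<in> D l x j \<and> \<not> saturated x M h e)) = (0::ennreal)"
        by (intro sum.neutral) auto
      then show ?thesis by simp
    qed
    have "(\<Sum>j<K. num x l j) = (\<integral>\<^sup>+F. reward A (saturated x M)
        (\<lambda>h e. \<Sum>j<K. of_bool (e \<in> D l x j \<and> \<not> saturated x M h e)) (\<lambda>_. \<Sum>j<K. 0) F t []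
        \<partial>cluster_answers n \<delta> s l)"
      unfolding num_def by (rule nn_integral_reward_sum) simp
    also have "\<dots> \<le> (\<integral>\<^sup>+F. reward A (saturated x M)
        (\<lambda>h e. of_bool (x \<in> e \<and> \<not> saturated x M h e)) (\<lambda>_. 0) F t [] \<partial>cluster_answers n \<delta> s l)"
      by (intro nn_integral_measure_pmf_mono reward_mono disj) simp
    also have "\<dots> \<le> (\<integral>\<^sup>+F. ennreal M \<partial>cluster_answers n \<delta> s l)"
      using reward_unsaturated_le[of x "[]" M A _ t] M by (intro nn_integral_measure_pmf_mono) simp
    finally show ?thesis by simp
  qed

  \<comment> \<open>Given \<open>\<sigma>(x := K)\<close>, the label \<open>\<sigma> x\<close> is
    uniform on \<open>K\<close> values, so the average of \<open>num\<close> is at most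
    \<open>M / K\<close>.\<close>
  have num_avg: "?k * (\<Sum>\<sigma>\<in>S. num x (\<sigma>(x := K)) (\<sigma> x)) \<le> ennreal (card S / 100)" if "x < n" for x
  proof -
    have "of_nat K * (\<Sum>\<sigma>\<in>S. num x (\<sigma>(x := K)) (\<sigma> x)) = (\<Sum>\<sigma>\<in>S. \<Sum>j<K. num x (\<sigma>(x := K)) j)"
      unfolding S_def using that by (intro sum_resample_label) simp
    also have "\<dots> \<le> (\<Sum>\<sigma>\<in>S. ennreal M)"
      by (intro sum_mono num_sum)
    finally have le: "of_nat K * (\<Sum>\<sigma>\<in>S. num x (\<sigma>(x := K)) (\<sigma> x)) \<le> ennreal (card S * M)"
      using M by (simp add: ennreal_mult ennreal_of_nat_eq_real_of_nat)
    have "?k * (\<Sum>\<sigma>\<in>S. num x (\<sigma>(x := K)) (\<sigma> x)) =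
        ennreal (200 * (1 - 2 * \<delta>)\<^sup>2 / K) * (of_nat K * (\<Sum>\<sigma>\<in>S. num x (\<sigma>(x := K)) (\<sigma> x)))"
      using K by (simp add: ennreal_of_nat_eq_real_of_nat mult.assoc[symmetric] flip: ennreal_mult)
    also have "\<dots> \<le> ennreal (200 * (1 - 2 * \<delta>)\<^sup>2 / K) * ennreal (card S * M)"
      by (intro mult_left_mono le) simp
    also have "\<dots> = ennreal ((200 * (1 - 2 * \<delta>)\<^sup>2 * M) * card S / K)"
      using M by (simp add: ac_simps flip: ennreal_mult)
    also have "\<dots> = ennreal (card S / 100)"
      unfolding kM using K by simp
    finally show ?thesis .
  qed

  have "(\<Sum>\<sigma>\<in>S. \<Sum>x<n. ennreal (37/50)) \<le> (\<Sum>\<sigma>\<in>S. \<Sum>x<n. out \<sigma> x + ennreal (1 / M) * tou \<sigma> x +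
      (ennreal (1/100) + ?k * num x (\<sigma>(x := K)) (\<sigma> x)))"
    by (intro sum_mono one) auto
  also have "\<dots> = (\<Sum>\<sigma>\<in>S. \<Sum>x<n. out \<sigma> x) + ennreal (1 / M) * (\<Sum>\<sigma>\<in>S. \<Sum>x<n. tou \<sigma> x) +
      ((\<Sum>\<sigma>\<in>S. \<Sum>x<n. ennreal (1/100)) + (\<Sum>x<n. ?k * (\<Sum>\<sigma>\<in>S. num x (\<sigma>(x := K)) (\<sigma> x))))"
    unfolding sum.distrib sum_distrib_left[symmetric]
    by (subst sum.swap[of "\<lambda>\<sigma> x. num x (\<sigma>(x := K)) (\<sigma> x)"]) simp
  also have "\<dots> \<le> (\<Sum>\<sigma>\<in>S. ennreal (real k)) + ennreal (1 / M) * (\<Sum>\<sigma>\<in>S. ennreal (2 * B)) +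
      ((\<Sum>\<sigma>\<in>S. \<Sum>x<n. ennreal (1/100)) + (\<Sum>x<n. ennreal (card S / 100)))"
    by (intro add_mono mult_left_mono sum_mono out_sum tou_sum num_avg) auto
  also have "\<dots> = ennreal (card S * (k + 2 * B / M + n / 50))"
    using M B by (simp add: ennreal_of_nat_eq_real_of_nat algebra_simps flip: ennreal_mult ennreal_plus)
  also have "(\<Sum>\<sigma>\<in>S. \<Sum>x<n. ennreal (37/50)) = ennreal (card S * (n * (37/50)))"
    by (simp add: ennreal_of_nat_eq_real_of_nat algebra_simps flip: ennreal_mult)
  finally have "card S * (n * (37/50)) \<le> card S * (k + 2 * B / M + n / 50)"
    using M B by (subst (asm) ennreal_le_iff) auto
  \<comment> \<open>The contradiction is numerical:
    \<open>2/3 + 1/25 + 1/50 < 37/50\<close>.\<close>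
  then have "n * (37/50) \<le> k + 2 * B / M + n / 50"
    using S by simp
  moreover have "2 * B / M \<le> n / 25"
    using BM M by (simp add: field_simps)
  moreover have "3 * real k \<le> 2 * real n"
    using kn by simp
  ultimately show False
    using kn by simp
qed

section \<open>Many centers\<close>

text \<open>Under \<open>min i k\<close> the points below \<open>k\<close> are singletons and all
  others share the label \<open>k\<close>; merging two singletons affects their own distance
  only.\<close>

lemma cluster_dist_merge_pair:
  assumes a: "a < k" and b: "b < k" and ab: "a \<noteq> b" and kn: "k < n"
  shows "cluster_dist n s (\<lambda>i. min i k) {a, b} = 1 \<and> cluster_dist n s ((\<lambda>i. min i k)(b := a)) {a, b} = s"
    and "e \<noteq> {a, b} \<Longrightarrow>
      cluster_dist n s ((\<lambda>i. min i k)(b := a)) e = cluster_dist n s (\<lambda>i. min i k) e"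
proof -
  show "cluster_dist n s (\<lambda>i. min i k) {a, b} = 1 \<and> cluster_dist n s ((\<lambda>i. min i k)(b := a)) {a, b} = s"
    using assms by (simp add: cluster_dist_pair)
  show "cluster_dist n s ((\<lambda>i. min i k)(b := a)) e = cluster_dist n s (\<lambda>i. min i k) e"
    if e: "e \<noteq> {a, b}"
  proof (cases "e \<in> point_pairs n")
    case True
    then obtain u v where uv: "e = {u, v}" "u \<noteq> v" "u < n" "v < n"
      by (auto simp: point_pairs_def card_2_iff)
    then have "(u = a \<longrightarrow> v \<noteq> b) \<and> (u = b \<longrightarrow> v \<noteq> a)"
      using e by (auto simp: insert_commute)
    then show ?thesis
      using uv assms by (auto simp: cluster_dist_pair min_def)
  qed (simp add: cluster_dist_def)
qed

lemma many_centers_bound: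
  assumes \<alpha>: "0 \<le> \<alpha>" and s: "0 < s" "s \<le> 1" "\<alpha> * (real n * s\<^sup>2) < 1"
    and kn: "3 \<le> k" "k < n" and \<delta>: "0 < \<delta>" "\<delta> < 1/2"
    and solves: "solves_kmeans \<alpha> n k \<delta> A" and B: "0 \<le> B"
    and queries: "\<And>l t. (\<integral>\<^sup>+F. reward A never (\<lambda>_ _. 1) (\<lambda>_. 0) F t [] \<partial>cluster_answers n \<delta> s l) \<le> ennreal B"
  shows "real k * real (k - 1) / (10000 * (1 - 2 * \<delta>)\<^sup>2) \<le> B"
proof (rule ccontr)
  let ?l0 = "\<lambda>i. min i k"
  define N where "N = real k * real (k - 1)"
  \<comment> \<open>Ordered pairs, so each unordered pair occurs twice; hence the factors 2
    below.\<close>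
  define P where "P = Sigma {..<k} (\<lambda>a. {..<k} - {a})"
  have \<epsilon>: "0 < (1 - 2 * \<delta>)\<^sup>2"
    using \<delta> by simp
  assume "\<not> ?thesis"
  then have BN: "10000 * (1 - 2 * \<delta>)\<^sup>2 * B < N"
    using \<epsilon> by (simp add: N_def not_le field_simps)
  have "card P = (\<Sum>a<k. k - 1)"
    unfolding P_def by (subst card_SigmaI) (auto intro!: sum.cong)
  then have P: "finite P" "real (card P) = N"
    by (auto simp: P_def N_def)

  define G where "G p = {C. \<exists>x\<in>{fst p, snd p}. {..<k} - C = {x}}" for p :: "nat \<times> nat"
  have "\<exists>t0. \<forall>t\<ge>t0. ennreal (37/50) \<le> (\<integral>\<^sup>+F. reward A never (\<lambda>_ _. 0) (\<lambda>C. of_bool (C \<in> G p)) F t []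
      \<partial>cluster_answers n \<delta> s (?l0(snd p := fst p)))" if p: "p \<in> P" for p
  proof (rule solves_imp_reward[OF solves s(1,2)])
    obtain a b where ab: "p = (a, b)" "a < k" "b < k" "a \<noteq> b"
      using p by (auto simp: P_def)
    define l where "l = ?l0(b := a)"
    have "card (l ` {..<n}) \<le> card ({..k} - {b})"
      using ab by (intro card_mono) (auto simp: l_def)
    then have card: "card (l ` {..<n}) \<le> k"
      using ab by simp
    show "approx_solutions \<alpha> (\<lambda>u v. cluster_dist n s (?l0(snd p := fst p)) {u, v}) {..<n} k \<subseteq> G p"
    proof
      fix C assume "C \<in> approx_solutions \<alpha> (\<lambda>u v. cluster_dist n s (?l0(snd p := fst p)) {u, v}) {..<n} k"
      then have C: "C \<in> approx_solutions \<alpha> (\<lambda>u v. cluster_dist n s l {u, v}) {..<n} k"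
        by (simp add: ab l_def)
      have hit: "\<exists>c\<in>C. l c = l x" if "x < n" for x
        using approx_solution_hits_cluster[OF s(1,3) \<alpha> card _ _ C that] kn by simp
      have C': "C \<subseteq> {..<n}" "card C = k"
        using C by (auto simp: approx_solutions_def center_sets_def)
      have others: "i \<in> C" if "i < k" "i \<noteq> a" "i \<noteq> b" for i
        using hit[of i] that kn ab by (auto simp: l_def min_def split: if_splits)
      have "a \<in> C \<or> b \<in> C"
        using hit[of a] kn ab by (auto simp: l_def min_def split: if_splits)
      \<comment> \<open>Otherwise all \<open>k\<close> points below \<open>k\<close> are centers,
        and the cluster labelled \<open>k\<close> demands one more.\<close>
      moreover have "\<not> (a \<in> C \<and> b \<in> C)"
      proof
        assume "a \<in> C \<and> b \<in> C"
        then have sub: "{..<k} \<subseteq> C"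
          using others by auto
        obtain c where "c \<in> C" "l c = l k"
          using hit[of k] kn by auto
        then have "c \<in> C" "c \<notin> {..<k}"
          using ab by (auto simp: l_def min_def split: if_splits)
        with sub have "card {..<k} < card C"
          using C' finite_subset by (intro psubset_card_mono) blast+
        with C' show False by simp
      qed
      ultimately have "{..<k} - C = {a} \<or> {..<k} - C = {b}"
        using others ab by auto
      then show "C \<in> G p"
        by (auto simp: G_def ab)
    qed
  qed
  then obtain t where succ: "\<And>p. p \<in> P \<Longrightarrow>
      ennreal (37/50) \<le> (\<integral>\<^sup>+F. reward A never (\<lambda>_ _. 0) (\<lambda>C. of_bool (C \<in> G p)) F t []
        \<partial>cluster_answers n \<delta> s (?l0(snd p := fst p)))"
    using eventually_all_finite[OF P(1), of "\<lambda>p t. ennreal (37/50) \<le>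
      (\<integral>\<^sup>+F. reward A never (\<lambda>_ _. 0) (\<lambda>C. of_bool (C \<in> G p)) F t []
        \<partial>cluster_answers n \<delta> s (?l0(snd p := fst p)))"]
    by blast

  \<comment> \<open>Both quantities refer to the unmerged labelling, which is common to all pairs,
    so they can be summed over \<open>P\<close>.\<close>
  define out where "out p = (\<integral>\<^sup>+F. reward A never (\<lambda>_ _. 0) (\<lambda>C. of_bool (C \<in> G p)) F t []
    \<partial>cluster_answers n \<delta> s ?l0)" for p
  define num where "num p = (\<integral>\<^sup>+F. reward A never (\<lambda>_ e. of_bool (e = {fst p, snd p})) (\<lambda>_. 0) F t []
    \<partial>cluster_answers n \<delta> s ?l0)" for p
  let ?k = "ennreal (200 * (1 - 2 * \<delta>)\<^sup>2)"

  have one: "ennreal (37/50) \<le> out p + (ennreal (1/100) + ?k * num p)" if p: "p \<in> P" for p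
  proof -
    obtain a b where ab: "p = (a, b)" "a < k" "b < k" "a \<noteq> b"
      using p by (auto simp: P_def)
    note merge = cluster_dist_merge_pair[OF ab(2-4) kn(2), where s = s]
    have "near (out p) (\<integral>\<^sup>+F. reward A never (\<lambda>_ _. 0) (\<lambda>C. of_bool (C \<in> G p)) F t []
        \<partial>cluster_answers n \<delta> s (?l0(snd p := fst p))) (ennreal (1/100) + ?k * num p)"
      using near_cluster_reward[OF \<delta>, of "{{a, b}}" n s ?l0 "?l0(b := a)" A never "G p" t] merge
      by (simp add: ab(1) out_def num_def del: fun_upd_apply)
    with succ[OF p] show ?thesis
      unfolding near_def by (meson order_trans)
  qed

  have out_sum: "(\<Sum>p\<in>P. out p) \<le> ennreal (2 * real (k - 1))"
  proof -
    have "(\<Sum>p\<in>P. of_bool (C \<in> G p)) \<le> ennreal (2 * real (k - 1))" for C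
    proof (cases "\<exists>x. {..<k} - C = {x}")
      case True
      then obtain x where x: "{..<k} - C = {x}" by blast
      then have "x < k" by auto
      \<comment> \<open>An output counts only if it omits a single point \<open>x\<close> below
        \<open>k\<close>, and then only for pairs that contain \<open>x\<close>.\<close>
      have "P \<inter> {p. C \<in> G p} \<subseteq> Pair x ` ({..<k} - {x}) \<union> (\<lambda>y. (y, x)) ` ({..<k} - {x})"
        using x by (auto simp: G_def P_def)
      then have "card (P \<inter> {p. C \<in> G p}) \<le> card (Pair x ` ({..<k} - {x}) \<union> (\<lambda>y. (y, x)) ` ({..<k} - {x}))"
        by (intro card_mono) auto
      also have "\<dots> \<le> card ({..<k} - {x}) + card ({..<k} - {x})"
        by (intro order_trans[OF card_Un_le] add_mono card_image_le) auto
      also have "\<dots> = 2 * (k - 1)"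
        using \<open>x < k\<close> by simp
      finally have "real (card (P \<inter> {p. C \<in> G p})) \<le> 2 * real (k - 1)"
        by (metis of_nat_le_iff of_nat_mult of_nat_numeral)
      then have "ennreal (real (card (P \<inter> {p. C \<in> G p}))) \<le> ennreal (2 * real (k - 1))"
        by (rule ennreal_leI)
      then show ?thesis
        using P(1) by (simp add: ennreal_of_nat_eq_real_of_nat del: One_nat_def)
    next
      case False
      then have "(\<Sum>p\<in>P. of_bool (C \<in> G p)) = (0::ennreal)"
        by (intro sum.neutral) (auto simp: G_def)
      then show ?thesis by simp
    qed
    then have "(\<integral>\<^sup>+F. reward A never (\<lambda>_ _. \<Sum>p\<in>P. 0) (\<lambda>C. \<Sum>p\<in>P. of_bool (C \<in> G p)) F t []
        \<partial>cluster_answers n \<delta> s ?l0) \<le> (\<integral>\<^sup>+F. ennreal (2 * real (k - 1)) \<partial>cluster_answers n \<delta> s ?l0)"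
      unfolding sum.neutral_const by (intro nn_integral_measure_pmf_mono reward_output_le)
    then show ?thesis
      unfolding out_def nn_integral_reward_sum[OF P(1)] by simp
  qed

  have num_sum: "(\<Sum>p\<in>P. num p) \<le> ennreal (2 * B)"
  proof -
    have two: "(\<Sum>p\<in>P. of_bool ({i, j} = {fst p, snd p})) \<le> (2 * 1 :: ennreal)" for i j
    proof -
      have "P \<inter> {p. {i, j} = {fst p, snd p}} \<subseteq> {(i, j), (j, i)}"
      proof
        fix p assume "p \<in> P \<inter> {p. {i, j} = {fst p, snd p}}"
        then have "i = fst p \<and> j = snd p \<or> i = snd p \<and> j = fst p"
          by (simp only: Int_iff mem_Collect_eq doubleton_eq_iff)
        then show "p \<in> {(i, j), (j, i)}"
          by (cases p) auto
      qed
      then have "card (P \<inter> {p. {i, j} = {fst p, snd p}}) \<le> card {(i, j), (j, i)}"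
        by (rule card_mono[rotated]) simp
      also have "\<dots> \<le> 2"
        by (cases "i = j") simp_all
      finally have "ennreal (real (card (P \<inter> {p. {i, j} = {fst p, snd p}}))) \<le> ennreal 2"
        by (intro ennreal_leI) (metis of_nat_le_iff of_nat_numeral)
      also have "ennreal (real (card (P \<inter> {p. {i, j} = {fst p, snd p}}))) =
          (\<Sum>p\<in>P. of_bool ({i, j} = {fst p, snd p}))"
        unfolding ennreal_of_nat_eq_real_of_nat[symmetric]
        using P(1) by (intro sum_of_bool_eq[symmetric])
      also have "ennreal 2 = 2 * 1"
        by simp
      finally show ?thesis .
    qed
    have "(\<Sum>p\<in>P. num p) = (\<integral>\<^sup>+F. reward A never (\<lambda>_ e. \<Sum>p\<in>P. of_bool (e = {fst p, snd p})) (\<lambda>_. \<Sum>p\<in>P. 0) F t []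
        \<partial>cluster_answers n \<delta> s ?l0)"
      unfolding num_def by (rule nn_integral_reward_sum[OF P(1)])
    also have "\<dots> \<le> (\<integral>\<^sup>+F. reward A never (\<lambda>_ _. 2 * 1) (\<lambda>_. 2 * 0) F t [] \<partial>cluster_answers n \<delta> s ?l0)"
      by (intro nn_integral_measure_pmf_mono reward_mono two) simp
    also have "\<dots> = 2 * (\<integral>\<^sup>+F. reward A never (\<lambda>_ _. 1) (\<lambda>_. 0) F t [] \<partial>cluster_answers n \<delta> s ?l0)"
      unfolding reward_cmult by (simp add: nn_integral_cmult)
    also have "\<dots> \<le> 2 * ennreal B"
      by (intro mult_left_mono queries) simp
    finally show ?thesis
      using B by (simp add: ennreal_mult)
  qed

  have "(\<Sum>p\<in>P. ennreal (37/50)) \<le> (\<Sum>p\<in>P. out p + (ennreal (1/100) + ?k * num p))"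
    by (intro sum_mono one)
  also have "\<dots> = (\<Sum>p\<in>P. out p) + ((\<Sum>p\<in>P. ennreal (1/100)) + ?k * (\<Sum>p\<in>P. num p))"
    by (simp only: sum.distrib sum_distrib_left)
  also have "\<dots> \<le> ennreal (2 * real (k - 1)) + ((\<Sum>p\<in>P. ennreal (1/100)) + ?k * ennreal (2 * B))"
    by (intro add_mono mult_left_mono out_sum num_sum) auto
  also have "\<dots> = ennreal (2 * real (k - 1) + (N / 100 + 200 * (1 - 2 * \<delta>)\<^sup>2 * (2 * B)))"
    using B P(2) by (simp add: ennreal_of_nat_eq_real_of_nat flip: ennreal_mult ennreal_plus)
  also have "(\<Sum>p\<in>P. ennreal (37/50)) = ennreal (N * (37/50))"
    using P(2) by (simp add: ennreal_of_nat_eq_real_of_nat flip: ennreal_mult)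
  finally have "N * (37/50) \<le> 2 * real (k - 1) + (N / 100 + 400 * ((1 - 2 * \<delta>)\<^sup>2 * B))"
    using B by (subst (asm) ennreal_le_iff) (auto simp: N_def)
  \<comment> \<open>This uses \<open>k \<ge> 3\<close>. It bounds the output term by
    \<open>2/3 * N\<close>, and \<open>2/3 + 1/100 + 1/25 < 37/50\<close>.\<close>
  moreover have "3 * real (k - 1) \<le> N"
    unfolding N_def using kn by (intro mult_right_mono) auto
  moreover have "0 < N"
    unfolding N_def using kn by simp
  ultimately show False
    using BN by simp
qed

theorem theorem3:
  fixes \<alpha> :: real
  assumes "\<alpha> \<ge> 1"
  shows "\<exists>c>0. \<forall>(n::nat) (k::nat) (\<delta>::real) A.
           2 \<le> k \<longrightarrow> k < n \<longrightarrow> 0 < \<delta> \<longrightarrow> \<delta> < 1 / 2 \<longrightarrow>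
           queries_points n A \<longrightarrow> solves_kmeans \<alpha> n k \<delta> A \<longrightarrow>
           (\<exists>d adv. Metric_space {..<n} d \<and>
              expected_queries n \<delta> d adv A \<ge> ennreal (c * (real n * real k / (1 - 2 * \<delta>)\<^sup>2)))"
proof (intro exI[of _ "1/4000000"] conjI allI impI)
  fix n k :: nat and \<delta> :: real and A
  assume kn: "2 \<le> k" "k < n" and \<delta>: "0 < \<delta>" "\<delta> < 1/2" and solves: "solves_kmeans \<alpha> n k \<delta> A"
  define E where "E = (1 - 2 * \<delta>)\<^sup>2"
  \<comment> \<open>The constant is small enough for both regimes: \<open>k - 1 \<ge> k / 2\<close>
    handles few centers, and \<open>n < 3 * k / 2\<close> handles many.\<close>
  define B where "B = 1/4000000 * (real n * real k / E)"
  \<comment> \<open>Small enough that \<open>\<alpha> * n * s < 1\<close>, which bounds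
    \<open>\<alpha> * n * s^2\<close> since \<open>s \<le> 1\<close>.\<close>
  define s where "s = 1 / (\<alpha> * real n + 1)"
  have E: "0 < E"
    using \<delta> by (simp add: E_def)
  have B: "0 \<le> B"
    using E by (simp add: B_def)
  have \<alpha>n: "0 < \<alpha> * real n"
    using assms kn by simp
  then have s: "0 < s" "s \<le> 1" and "\<alpha> * real n * s < 1"
    by (simp_all add: s_def field_simps)
  moreover have "\<alpha> * real n * s * s \<le> \<alpha> * real n * s"
    using s \<alpha>n by (intro mult_left_le) auto
  ultimately have small: "\<alpha> * (real n * s\<^sup>2) < 1"
    by (simp add: power2_eq_square mult.assoc)
  show "\<exists>d adv. Metric_space {..<n} d \<and>
      expected_queries n \<delta> d adv A \<ge> ennreal (1/4000000 * (real n * real k / (1 - 2 * \<delta>)\<^sup>2))"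
  proof (rule ccontr)
    assume "\<not> ?thesis"
    then have "expected_queries n \<delta> (\<lambda>x y. cluster_dist n s l {x, y}) (swapped_dist n s l) A \<le> ennreal B" for l
      using Metric_space_cluster_dist[OF s, of n l] unfolding B_def E_def by (meson linear)
    then have queries: "(\<integral>\<^sup>+F. reward A never (\<lambda>_ _. 1) (\<lambda>_. 0) F t [] \<partial>cluster_answers n \<delta> s l) \<le> ennreal B" for l t
      using cluster_reward_le_expected_queries order_trans by blast
    have \<alpha>: "0 \<le> \<alpha>"
      using assms by simp
    show False
    proof (cases "3 * k \<le> 2 * n")
      case True
      have "real n * real (k - 1) / (1000000 * E) \<le> B"
        unfolding E_def by (rule few_centers_bound[OF \<alpha> s small kn True \<delta> solves B queries])
      then have "4 * (real n * real (k - 1)) \<le> real n * real k"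
        using E by (simp add: B_def field_simps)
      then have "real n * (4 * real (k - 1)) \<le> real n * real k"
        by simp
      then have "4 * real (k - 1) \<le> real k"
        using kn by simp
      then show False
        using kn by (simp add: of_nat_diff)
    next
      case False
      then have k: "3 \<le> k"
        using kn by simp
      have "real k * real (k - 1) / (10000 * E) \<le> B"
        unfolding E_def by (rule many_centers_bound[OF \<alpha> s small k kn(2) \<delta> solves B queries])
      then have "real k * (400 * real (k - 1)) \<le> real k * real n"
        using E by (simp add: B_def field_simps)
      then have "400 * real (k - 1) \<le> real n"
        using k by simp
      then show False
        using k False by (simp add: of_nat_diff)
    qed
  qed
qed simp

end
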